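(* Let $A$, $B$, $B'$ and $C$ be matrices in $\mathbb{C}^{d\times d}$, with $C+kI$ invertible for all integers $k\ge0$. Then the matrix function $\mathcal{H}_2(A,B,B';C;x,y)$ satisfies the following differential formulae, where $r$ is a positive integer: (1) if $AB=BA$, $\dfrac{\partial^r}{\partial x^r}\mathcal{H}_2(A,B,B';C;x,y)=(A)_r(B)_r\,\mathcal{H}_2(A+rI,B+rI,B';C+rI;x,y)\,(C)_r^{-1}$; (2) if $CB'=B'C$, $\dfrac{\partial^r}{\partial y^r}\mathcal{H}_2(A,B,B';C;x,y)=(-1)^r(I-A)_r^{-1}\,\mathcal{H}_2(A-rI,B,B'+rI;C;x,y)\,(B')_r$; (3) $\Big(x^2\dfrac{\partial}{\partial x}\Big)^r\big[x^{A+(r-1)I}\mathcal{H}_2(A,B,B';C;x,\tfrac{y}{x})\big]=x^{A+rI}(A)_r\,\mathcal{H}_2(A+rI,B,B';C;x,\tfrac{y}{x})$; (4) if $AB=BA$, $\Big(x^2\dfrac{\partial}{\partial x}\Big)^r\big[x^{B+(r-1)I}\mathcal{H}_2(A,B,B';C;x,y)\big]=x^{B+rI}(B)_r\,\mathcal{H}_2(A,B+rI,B';C;x,y)$; (5) if $CB'=B'C$, $\Big(y^2\dfrac{\partial}{\partial y}\Big)^r\big[\mathcal{H}_2(A,B,B';C;x,y)\,y^{B'+(r-1)I}\big]=\mathcal{H}_2(A,B,B'+rI;C;x,y)\,y^{B'+rI}(B')_r$; (6) $\dfrac{\partial^r}{\partial x^r}\big[\mathcal{H}_2(A,B,B';C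;x,y)\,x^{C-I}\big]=(-1)^r\,\mathcal{H}_2(A,B,B';C-rI;x,y)\,x^{C-(r+1)I}(I-C)_r$.
   Context: $\mathcal{H}_2(A,B,B';C;x,y)=\sum_{m,n\ge0}(A)_{m-n}(B)_m(B')_n(C)_m^{-1}\frac{x^m y^n}{m!\,n!}$. Matrix Pochhammer symbol: for $M\in\mathbb{C}^{d\times d}$, $(M)_0=I$, $(M)_n=M(M+I)\cdots(M+(n-1)I)$ for $n\ge1$, and $(M)_{-n}=(-1)^n(I-M)_n^{-1}$; $(M)_n^{-1}$ is the inverse matrix of $(M)_n$. Matrix powers: $x^M=\exp(M\log x)$.
   Formalization: (3)–(5) are false as printed for r≥2; the bracket powers are x^A, x^B, y^{B'} instead of x^{A+(r-1)I}, x^{B+(r-1)I}, y^{B'+(r-1)I}. Also assumed: (A)_{-n}, (A+rI)_{-n} in (1),(3) and (C-rI)_m^{-1} in (6) exist; |x|<1; matrix powers off the cut (-∞,0]. *)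

theory Defs
  imports "HOL-Analysis.Analysis"
begin

(* A d x d complex matrix has type complex^'d^'d.  The class operations times, power and exp on
   that type act entrywise (or are unavailable), so the matrix operations below are built on the
   matrix product **, with mat c = c I. *)

definition cscale :: "complex \<Rightarrow> complex^'d^'d \<Rightarrow> complex^'d^'d"  (infixr "*\<^sub>M" 72)
  where "c *\<^sub>M M = (\<chi> i j. c * M $ i $ j)"

definition mat_pow :: "complex^'d^'d \<Rightarrow> nat \<Rightarrow> complex^'d^'d"
  where "mat_pow M k = (((**) M) ^^ k) (mat 1)"

definition mat_exp :: "complex^'d^'d \<Rightarrow> complex^'d^'d"
  where "mat_exp M = (\<Sum>k. (1 / fact k) *\<^sub>M mat_pow M k)"

(* x^M = exp (M log x) with the principal branch; meant for x outside the cut (-infinity, 0]. *)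
definition mat_powr :: "complex \<Rightarrow> complex^'d^'d \<Rightarrow> complex^'d^'d"
  where "mat_powr x M = mat_exp (Ln x *\<^sub>M M)"

primrec mat_poch :: "complex^'d^'d \<Rightarrow> nat \<Rightarrow> complex^'d^'d"
  where
    "mat_poch M 0 = mat 1"
  | "mat_poch M (Suc n) = mat_poch M n ** (M + mat (of_nat n))"

definition mat_poch_int :: "complex^'d^'d \<Rightarrow> int \<Rightarrow> complex^'d^'d"
  where "mat_poch_int M k =
    (if k \<ge> 0 then mat_poch M (nat k)
     else (-1) ^ nat (- k) *\<^sub>M matrix_inv (mat_poch (mat 1 - M) (nat (- k))))"

(* matrix_inv is unspecified on singular matrices: this says that the inverses defining the
   symbols of M at all negative indices exist. *)
definition neg_poch_defined :: "complex^'d^'d \<Rightarrow> bool"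
  where "neg_poch_defined M \<longleftrightarrow> (\<forall>n. invertible (mat_poch (mat 1 - M) n))"

definition horn_H2 ::
  "complex^'d^'d \<Rightarrow> complex^'d^'d \<Rightarrow> complex^'d^'d \<Rightarrow> complex^'d^'d \<Rightarrow>
   complex \<Rightarrow> complex \<Rightarrow> complex^'d^'d"
  where "horn_H2 A B B' C x y =
    (\<Sum>\<^sub>\<infinity>(m, n)\<in>UNIV. (x ^ m * y ^ n / (fact m * fact n)) *\<^sub>M
      (mat_poch_int A (int m - int n) ** mat_poch B m ** mat_poch B' n ** matrix_inv (mat_poch C m)))"

definition mat_holomorphic_on :: "(complex \<Rightarrow> complex^'d^'d) \<Rightarrow> complex set \<Rightarrow> bool"
    (infix "mat'_holomorphic'_on" 50)
  where "F mat_holomorphic_on S \<longleftrightarrow> (\<forall>i j. (\<lambda>t. F t $ i $ j) holomorphic_on S)"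

definition mat_deriv :: "(complex \<Rightarrow> complex^'d^'d) \<Rightarrow> complex \<Rightarrow> complex^'d^'d"
  where "mat_deriv F t = (\<chi> i j. deriv (\<lambda>s. F s $ i $ j) t)"

(* the operator t^2 d/dt *)
definition sq_deriv :: "(complex \<Rightarrow> complex^'d^'d) \<Rightarrow> complex \<Rightarrow> complex^'d^'d"
  where "sq_deriv F t = t\<^sup>2 *\<^sub>M mat_deriv F t"

end

theory Submission
  imports Defs "HOL-Complex_Analysis.Cauchy_Integral_Formula"
begin

text \<open>
  Write \<open>c m n\<close> for the matrix coefficient of \<open>x\<^sup>m y\<^sup>n\<close>. Everything rests on two facts.

  Convergence. The matrices \<open>(B)\<^sub>m\<close> and \<open>m!\<close>, and the inverse of \<open>(C)\<^sub>m\<close> and \<open>1 / m!\<close>, differ by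
  factors of subexponential growth, and \<open>(A)\<^bsub>m-n\<^esub> / m!\<close> is of size at most \<open>2\<^sup>n / n!\<close> up to
  such factors. Hence, for each \<open>\<rho> > 1\<close>, the norm of \<open>c m n\<close> is at most \<open>K \<rho>\<^sup>m L\<^sup>n / n!\<close>
  (\<open>h2_growth_h2_coeff\<close>): the series converges for \<open>\<bar>x\<bar> < 1\<close> and every \<open>y\<close>, locally uniformly, and
  by the theorem of Weierstrass it may be differentiated termwise along any holomorphic curve in this domain
  (\<open>horn_H2_has_mat_deriv\<close>).

  Contiguity. The functional equation \<open>(M)\<^bsub>k+1\<^esub> = (M)\<^sub>k (M + k I) = M (M + I)\<^sub>k\<close>, which for \<open>A\<close>
  holds at all integers \<open>k\<close> for which the symbols are defined, translates each first-order operator applied to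
  the series into a series with shifted parameters. The operators \<open>\<partial>/\<partial>x\<close> and \<open>\<partial>/\<partial>y\<close> shift the
  summation index (\<open>h2_coeff_shift_m\<close>, \<open>h2_coeff_shift_n\<close>). In the other formulae the power \<open>t\<^sup>M\<close>
  turns the Euler operator \<open>t d/dt\<close> into \<open>M + t d/dt\<close>, which multiplies the term of exponent \<open>e\<close> by
  \<open>M + e I\<close>; this factor completes the symbol with parameter \<open>M\<close>, or cancels a factor of the inverse symbol
  when \<open>M = C - I\<close> (the lemmas \<open>h2_coeff_euler_A\<close>, \<open>h2_coeff_euler_B\<close>,
  \<open>h2_coeff_euler_B'\<close> and \<open>h2_coeff_euler_C\<close>). Matrices do not commute, so the position of each factor
  matters; the commutation hypotheses are what moves the factor pulled out to the outside.

  Each formula thus holds for order one, with a shifted function of the same kind on the right. The general order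
  follows by induction, the factors pulled out building up Pochhammer symbols.
\<close>

section \<open>Matrix algebra\<close>

lemma cscale_nth [simp]: "(c *\<^sub>M X) $ i $ j = c * X $ i $ j"
  by (simp add: cscale_def)

lemma cscale_mult_left [simp]: "(c *\<^sub>M X) ** Y = c *\<^sub>M (X ** Y)"
  by (simp add: vec_eq_iff matrix_matrix_mult_def sum_distrib_left mult.assoc)

lemma cscale_mult_right [simp]: "X ** (c *\<^sub>M Y) = c *\<^sub>M (X ** Y)"
  by (simp add: vec_eq_iff matrix_matrix_mult_def sum_distrib_left mult.left_commute)

lemma cscale_add_right: "c *\<^sub>M (X + Y) = c *\<^sub>M X + c *\<^sub>M Y"
  by (simp add: vec_eq_iff distrib_left)

lemma cscale_cscale [simp]: "c *\<^sub>M d *\<^sub>M X = (c * d) *\<^sub>M X"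
  by (simp add: vec_eq_iff mult.assoc)

lemma cscale_1 [simp]: "1 *\<^sub>M X = X"
  by (simp add: vec_eq_iff)

lemma cscale_0 [simp]: "0 *\<^sub>M X = 0"
  by (simp add: vec_eq_iff)

lemma cscale_zero [simp]: "c *\<^sub>M (0 :: complex^'d^'d) = 0"
  by (simp add: vec_eq_iff)

lemma cscale_minus_left: "(- c) *\<^sub>M X = - (c *\<^sub>M X)"
  by (simp add: vec_eq_iff)

lemma mat_mult_left [simp]: "mat c ** X = c *\<^sub>M (X :: complex^'d^'d)"
  by (simp add: vec_eq_iff matrix_matrix_mult_def mat_def if_distrib[where f="\<lambda>x. x * _"] cong: if_cong)

lemma mat_mult_right [simp]: "X ** mat c = c *\<^sub>M (X :: complex^'d^'d)"
  by (simp add: vec_eq_iff matrix_matrix_mult_def mat_def if_distrib[where f="\<lambda>x. _ * x"] mult.commute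
      cong: if_cong)

lemma mat_add: "mat (a + b) = mat a + (mat b :: complex^'d^'d)"
  by (simp add: vec_eq_iff mat_def)

lemma matrix_add_rdistrib: "(X + Y) ** Z = X ** Z + Y ** (Z :: complex^'d^'d)"
  by (simp add: vec_eq_iff matrix_matrix_mult_def sum.distrib distrib_right)

lemma matrix_minus_mult_left: "(- X) ** Y = - (X ** (Y :: complex^'d^'d))"
  by (simp add: vec_eq_iff matrix_matrix_mult_def sum_negf)

lemma matrix_minus_mult_right: "X ** (- Y) = - (X ** (Y :: complex^'d^'d))"
  by (simp add: vec_eq_iff matrix_matrix_mult_def sum_negf)

lemma matrix_diff_ldistrib: "X ** (Y - Z) = X ** Y - X ** (Z :: complex^'d^'d)"
  by (simp add: vec_eq_iff matrix_matrix_mult_def sum_subtractf right_diff_distrib)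

lemma matrix_diff_rdistrib: "(X - Y) ** Z = X ** Z - Y ** (Z :: complex^'d^'d)"
  by (simp add: vec_eq_iff matrix_matrix_mult_def sum_subtractf left_diff_distrib)

lemmas matrix_distribs = matrix_add_ldistrib matrix_add_rdistrib matrix_diff_ldistrib
  matrix_diff_rdistrib matrix_minus_mult_left matrix_minus_mult_right

lemma matrix_inv_inverse:
  assumes "invertible (X :: complex^'d^'d)"
  shows "X ** matrix_inv X = mat 1" and "matrix_inv X ** X = mat 1"
  using assms someI_ex[of "\<lambda>Y. X ** Y = mat 1 \<and> Y ** X = mat 1"]
  unfolding invertible_def matrix_inv_def by blast+

lemma matrix_inv_mat_1 [simp]: "matrix_inv (mat 1 :: complex^'d^'d) = mat 1"
  using matrix_inv_inverse(1)[of "mat 1 :: complex^'d^'d"] by (simp add: invertible_def)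

lemma invertible_if_mult_eq_1:
  assumes "X ** Y = (mat 1 :: complex^'d^'d)"
  shows "invertible X" "invertible (Y :: complex^'d^'d)"
  using assms invertible_right_inverse[of X] invertible_left_inverse[of Y] by blast+

lemma invertible_cancel_left:
  assumes "invertible (X :: complex^'d^'d)" "X ** Y = X ** Z"
  shows "Y = Z"
  by (metis assms matrix_inv_inverse(2) matrix_mul_assoc matrix_mul_lid)

lemma invertible_cancel_right:
  assumes "invertible (X :: complex^'d^'d)" "Y ** X = Z ** X"
  shows "Y = Z"
  by (metis assms matrix_inv_inverse(1) matrix_mul_assoc matrix_mul_rid)

lemma invertible_mult_right_factor:
  assumes "invertible (X ** (Y :: complex^'d^'d))"
  shows "invertible Y"
  by (metis assms invertible_def invertible_left_inverse matrix_mul_assoc)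

lemma matrix_inv_mult:
  assumes "invertible (X :: complex^'d^'d)" "invertible (Y :: complex^'d^'d)"
  shows "matrix_inv (X ** Y) = matrix_inv Y ** matrix_inv X"
proof (rule invertible_cancel_left[of "X ** Y"])
  show XY: "invertible (X ** Y)"
    by (simp add: assms invertible_mult)
  from XY show "(X ** Y) ** matrix_inv (X ** Y) = (X ** Y) ** (matrix_inv Y ** matrix_inv X)"
    by (metis assms matrix_inv_inverse(1) matrix_mul_assoc matrix_mul_rid)
qed

lemma matrix_inv_commute:
  assumes "invertible (X :: complex^'d^'d)" "X ** Y = Y ** X"
  shows "matrix_inv X ** Y = Y ** matrix_inv X"
  by (metis assms matrix_inv_inverse matrix_mul_assoc matrix_mul_lid matrix_mul_rid)

lemma invertible_uminus:
  assumes "invertible (X :: complex^'d^'d)"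
  shows "invertible (- X)"
  by (rule invertible_if_mult_eq_1(1)[of _ "- matrix_inv X"])
     (simp add: matrix_distribs matrix_inv_inverse assms)

lemma bounded_bilinear_matrix_mult:
  "bounded_bilinear ((**) :: complex^'d^'d \<Rightarrow> complex^'d^'d \<Rightarrow> complex^'d^'d)"
  unfolding bilinear_conv_bounded_bilinear[symmetric] bilinear_def
  by (intro conjI allI linearI)
     (simp_all add: vec_eq_iff matrix_matrix_mult_def scaleR_sum_right sum.distrib ring_distribs)

text \<open>A crude constant suffices: in the growth estimates a factor \<open>M + k I\<close> contributes its scalar part
\<open>k I\<close>, which decides the growth, exactly, and the constant affects only the fixed part \<open>M\<close>.\<close>

lemma norm_matrix_mult_le:
  obtains K :: real where "K > 0"
    and "\<And>(X :: complex^'d^'d) (Y :: complex^'d^'d). norm (X ** Y) \<le> norm X * norm Y * K"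
  using bounded_bilinear.pos_bounded[OF bounded_bilinear_matrix_mult[where 'd='d]] that by auto

lemma norm_cscale [simp]: "norm (c *\<^sub>M X) = norm c * norm X"
proof -
  have "norm (c *\<^sub>M X) = L2_set (\<lambda>i. norm c * L2_set (\<lambda>j. norm (X $ i $ j)) UNIV) UNIV"
    by (simp add: norm_vec_def norm_mult L2_set_right_distrib)
  also have "\<dots> = norm c * norm X"
    by (simp add: norm_vec_def L2_set_right_distrib)
  finally show ?thesis .
qed

lemma norm_nth_nth_le: "norm (X $ i $ j) \<le> norm (X :: complex^'d^'d)"
  by (rule order_trans[OF Finite_Cartesian_Product.norm_nth_le Finite_Cartesian_Product.norm_nth_le])

section \<open>Complex derivatives of matrix functions\<close>

definition has_mat_deriv ::
  "(complex \<Rightarrow> complex^'d^'d) \<Rightarrow> complex^'d^'d \<Rightarrow> complex \<Rightarrow> bool"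
  where "has_mat_deriv F D t \<longleftrightarrow>
    (\<forall>i j. ((\<lambda>s. F s $ i $ j) has_field_derivative D $ i $ j) (at t))"

lemma has_mat_deriv_imp_mat_deriv: "has_mat_deriv F D t \<Longrightarrow> mat_deriv F t = D"
  by (simp add: has_mat_deriv_def mat_deriv_def vec_eq_iff DERIV_imp_deriv)

lemma has_mat_deriv_imp_holomorphic:
  assumes "open S" "\<And>t. t \<in> S \<Longrightarrow> has_mat_deriv F (D t) t"
  shows "F mat_holomorphic_on S"
  using assms unfolding mat_holomorphic_on_def has_mat_deriv_def
  by (meson holomorphic_on_open)

lemma has_mat_deriv_const: "has_mat_deriv (\<lambda>t. X) 0 t"
  by (simp add: has_mat_deriv_def)

lemma has_mat_deriv_cscale:
  assumes "(f has_field_derivative f') (at t)" "has_mat_deriv F D t"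
  shows "has_mat_deriv (\<lambda>s. f s *\<^sub>M F s) (f' *\<^sub>M F t + f t *\<^sub>M D) t"
  using assms unfolding has_mat_deriv_def
  by (auto intro!: derivative_eq_intros)

lemma has_mat_deriv_mult:
  assumes "has_mat_deriv F D t" "has_mat_deriv G E t"
  shows "has_mat_deriv (\<lambda>s. F s ** G s) (D ** G t + F t ** E) t"
  unfolding has_mat_deriv_def
proof (intro allI)
  fix i j
  have "((\<lambda>s. F s $ i $ k * G s $ k $ j) has_field_derivative
      D $ i $ k * G t $ k $ j + F t $ i $ k * E $ k $ j) (at t)" for k
    using DERIV_mult[of "\<lambda>s. F s $ i $ k" "D $ i $ k" t UNIV "\<lambda>s. G s $ k $ j" "E $ k $ j"] assms
    by (simp add: has_mat_deriv_def mult.commute)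
  then have "((\<lambda>s. \<Sum>k\<in>UNIV. F s $ i $ k * G s $ k $ j) has_field_derivative
      (\<Sum>k\<in>UNIV. D $ i $ k * G t $ k $ j + F t $ i $ k * E $ k $ j)) (at t)"
    by (intro DERIV_sum)
  then show "((\<lambda>s. (F s ** G s) $ i $ j) has_field_derivative (D ** G t + F t ** E) $ i $ j) (at t)"
    by (simp add: matrix_matrix_mult_def sum.distrib)
qed

lemma has_mat_deriv_mult_left:
  assumes "has_mat_deriv F D t"
  shows "has_mat_deriv (\<lambda>s. X ** F s) (X ** D) t"
  using has_mat_deriv_mult[OF has_mat_deriv_const assms] by simp

lemma has_mat_deriv_mult_right:
  assumes "has_mat_deriv F D t"
  shows "has_mat_deriv (\<lambda>s. F s ** X) (D ** X) t"
  using has_mat_deriv_mult[OF assms has_mat_deriv_const] by simp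

lemma has_mat_deriv_chain:
  assumes "(g has_field_derivative g') (at t)" "has_mat_deriv F D (g t)"
  shows "has_mat_deriv (\<lambda>s. F (g s)) (g' *\<^sub>M D) t"
  unfolding has_mat_deriv_def
proof (intro allI)
  fix i j
  have "((\<lambda>s. F s $ i $ j) has_field_derivative D $ i $ j) (at (g t))"
    using assms(2) by (simp add: has_mat_deriv_def)
  from DERIV_chain2[OF this assms(1)]
  show "((\<lambda>s. F (g s) $ i $ j) has_field_derivative (g' *\<^sub>M D) $ i $ j) (at t)"
    by (simp add: mult.commute)
qed

lemma mat_deriv_cong:
  assumes "open S" "t \<in> S" "\<And>s. s \<in> S \<Longrightarrow> F s = G s"
  shows "mat_deriv F t = mat_deriv G t"
proof -
  have "eventually (\<lambda>s. F s = G s) (nhds t)"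
    using assms eventually_nhds by blast
  then have "deriv (\<lambda>s. F s $ i $ j) t = deriv (\<lambda>s. G s $ i $ j) t" for i j
    by (intro deriv_cong_ev refl) (auto elim: eventually_mono)
  then show ?thesis
    by (simp add: mat_deriv_def)
qed

text \<open>Equality of a derivative with the next function is only known on an open set, while the operator acts on
functions defined everywhere. This suffices because derivatives are local.\<close>

lemma mat_deriv_iterate:
  assumes "open S" "x \<in> S"
    and "\<And>k t. k < r \<Longrightarrow> t \<in> S \<Longrightarrow> has_mat_deriv (G k) (G (Suc k) t) t"
  shows "(mat_deriv ^^ r) (G 0) x = G r x"
  using assms(2,3)
proof (induction r arbitrary: x)
  case (Suc r)
  have "(mat_deriv ^^ Suc r) (G 0) x = mat_deriv ((mat_deriv ^^ r) (G 0)) x"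
    by simp
  also have "\<dots> = mat_deriv (G r) x"
    by (rule mat_deriv_cong[OF assms(1) Suc.prems(1)]) (use Suc in auto)
  also have "\<dots> = G (Suc r) x"
    using Suc.prems by (intro has_mat_deriv_imp_mat_deriv) auto
  finally show ?case .
qed auto

lemma sq_deriv_iterate:
  assumes "open S" "x \<in> S"
    and "\<And>k t. k < r \<Longrightarrow> t \<in> S \<Longrightarrow> has_mat_deriv (G k) (D k t) t"
    and "\<And>k t. k < r \<Longrightarrow> t \<in> S \<Longrightarrow> t\<^sup>2 *\<^sub>M D k t = G (Suc k) t"
  shows "(sq_deriv ^^ r) (G 0) x = G r x"
  using assms(2-4)
proof (induction r arbitrary: x)
  case (Suc r)
  have "(sq_deriv ^^ Suc r) (G 0) x = x\<^sup>2 *\<^sub>M mat_deriv ((sq_deriv ^^ r) (G 0)) x"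
    by (simp add: sq_deriv_def)
  also have "mat_deriv ((sq_deriv ^^ r) (G 0)) x = mat_deriv (G r) x"
    by (rule mat_deriv_cong[OF assms(1) Suc.prems(1)]) (use Suc in auto)
  also have "\<dots> = D r x"
    using Suc.prems by (intro has_mat_deriv_imp_mat_deriv) auto
  also have "x\<^sup>2 *\<^sub>M D r x = G (Suc r) x"
    using Suc.prems by simp
  finally show ?case .
qed auto

section \<open>Matrix powers\<close>

lemma mat_pow_0 [simp]: "mat_pow M 0 = mat 1"
  and mat_pow_Suc: "mat_pow M (Suc k) = M ** mat_pow M k"
  by (simp_all add: mat_pow_def)

lemma mat_pow_cscale: "mat_pow (z *\<^sub>M M) k = z ^ k *\<^sub>M mat_pow M k"
  by (induction k) (simp_all add: mat_pow_Suc mult.commute)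

lemma mat_pow_commute:
  assumes "X ** M = M ** X"
  shows "X ** mat_pow M k = mat_pow M k ** X"
  by (induction k) (simp_all add: mat_pow_Suc, metis assms matrix_mul_assoc)

lemma mat_exp_summable: "summable (\<lambda>k. norm ((1 / fact k) *\<^sub>M mat_pow M k))"
proof -
  obtain K :: real where K: "K > 0"
    and mult: "\<And>(X :: complex^'a^'a) (Y :: complex^'a^'a). norm (X ** Y) \<le> norm X * norm Y * K"
    using norm_matrix_mult_le by blast
  have "norm (mat_pow M k) \<le> (norm M * K) ^ k * norm (mat 1 :: complex^'a^'a)" for k
  proof (induction k)
    case (Suc k)
    have "norm (mat_pow M (Suc k)) \<le> norm M * norm (mat_pow M k) * K"
      by (simp only: mat_pow_Suc mult)
    also have "\<dots> \<le> norm M * ((norm M * K) ^ k * norm (mat 1 :: complex^'a^'a)) * K"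
      using Suc K by (intro mult_right_mono mult_left_mono) auto
    finally show ?case by (simp add: mult_ac)
  qed auto
  then have "norm (norm ((1 / fact k) *\<^sub>M mat_pow M k))
      \<le> (norm M * K) ^ k /\<^sub>R fact k * norm (mat 1 :: complex^'a^'a)" for k
    by (simp add: norm_divide divide_simps mult.commute)
  then show ?thesis
    by (intro summable_comparison_test'[where N=0, OF summable_mult2[OF summable_exp_generic]])
qed

lemma mat_exp_sums: "(\<lambda>k. (1 / fact k) *\<^sub>M mat_pow M k) sums mat_exp M"
  unfolding mat_exp_def by (rule summable_sums[OF summable_norm_cancel[OF mat_exp_summable]])

lemma mat_exp_commute:
  assumes "X ** M = M ** X"
  shows "X ** mat_exp M = mat_exp M ** X"
proof -
  let ?f = "\<lambda>k. (1 / fact k) *\<^sub>M mat_pow M k"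
  have "(\<lambda>k. X ** ?f k) sums (X ** mat_exp M)" "(\<lambda>k. ?f k ** X) sums (mat_exp M ** X)"
    by (rule bounded_linear.sums[OF bounded_bilinear.bounded_linear_right
          [OF bounded_bilinear_matrix_mult] mat_exp_sums],
        rule bounded_linear.sums[OF bounded_bilinear.bounded_linear_left
          [OF bounded_bilinear_matrix_mult] mat_exp_sums])
  moreover have "X ** ?f k = ?f k ** X" for k
    by (simp add: mat_pow_commute[OF assms])
  ultimately show ?thesis
    by (simp add: sums_unique2)
qed

lemma sums_nth_nth:
  fixes f :: "nat \<Rightarrow> complex^'d^'d"
  assumes "f sums S"
  shows "(\<lambda>k. f k $ i $ j) sums (S $ i $ j)"
proof -
  have "bounded_linear (\<lambda>X :: complex^'d^'d. X $ i $ j)"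
    by (intro bounded_linear_compose[OF bounded_linear_vec_nth bounded_linear_vec_nth])
  then show ?thesis
    using assms by (rule bounded_linear.sums)
qed

lemma has_mat_deriv_mat_exp: "has_mat_deriv (\<lambda>z. mat_exp (z *\<^sub>M M)) (M ** mat_exp (z *\<^sub>M M)) z"
  unfolding has_mat_deriv_def
proof (intro allI)
  fix i j
  define a where "a = (\<lambda>k. mat_pow M k $ i $ j / fact k)"
  have entry: "(\<lambda>k. a k * z ^ k) sums (mat_exp (z *\<^sub>M M) $ i $ j)" for z
    using sums_nth_nth[OF mat_exp_sums[of "z *\<^sub>M M"], of i j]
    by (simp add: mat_pow_cscale a_def mult.commute)
  have "((\<lambda>z. \<Sum>k. a k * z ^ k) has_field_derivative (\<Sum>k. diffs a k * z ^ k)) (at z)"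
    by (rule termdiffs_strong_converges_everywhere) (use entry in \<open>auto simp: sums_iff\<close>)
  also have "(\<lambda>z. \<Sum>k. a k * z ^ k) = (\<lambda>z. mat_exp (z *\<^sub>M M) $ i $ j)"
    using entry by (simp add: sums_iff)
  also have "(\<Sum>k. diffs a k * z ^ k) = (M ** mat_exp (z *\<^sub>M M)) $ i $ j"
  proof -
    have "(\<lambda>k. M ** ((1 / fact k) *\<^sub>M mat_pow (z *\<^sub>M M) k)) sums (M ** mat_exp (z *\<^sub>M M))"
      by (rule bounded_linear.sums[OF bounded_bilinear.bounded_linear_right
            [OF bounded_bilinear_matrix_mult] mat_exp_sums])
    from sums_nth_nth[OF this, of i j]
    have "(\<lambda>k. z ^ k / fact k * mat_pow M (Suc k) $ i $ j) sums (M ** mat_exp (z *\<^sub>M M)) $ i $ j"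
      by (simp add: mat_pow_cscale mat_pow_Suc)
    moreover have "diffs a k * z ^ k = z ^ k / fact k * mat_pow M (Suc k) $ i $ j" for k
      by (simp add: diffs_def a_def field_simps del: of_nat_Suc)
    ultimately show ?thesis
      by (simp add: sums_iff)
  qed
  finally show "((\<lambda>z. mat_exp (z *\<^sub>M M) $ i $ j) has_field_derivative (M ** mat_exp (z *\<^sub>M M)) $ i $ j) (at z)" .
qed

lemma mat_exp_0 [simp]: "mat_exp (0 :: complex^'d^'d) = mat 1"
proof -
  have "mat_pow (0 :: complex^'d^'d) k = (if k = 0 then mat 1 else 0)" for k
    by (cases k) (simp_all add: mat_pow_Suc)
  then have "(\<lambda>k. (1 / fact k) *\<^sub>M mat_pow (0 :: complex^'d^'d) k) = (\<lambda>k. if k = 0 then mat 1 else 0)"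
    by (auto simp: fun_eq_iff)
  then have "(\<lambda>k. if k = 0 then mat 1 else 0) sums mat_exp (0 :: complex^'d^'d)"
    using mat_exp_sums[of "0 :: complex^'d^'d"] by simp
  then show ?thesis
    using sums_unique2 sums_single[of 0 "\<lambda>_. mat 1 :: complex^'d^'d"] by blast
qed

text \<open>Uniqueness for the linear equation \<open>G' = M G\<close>: the product of \<open>exp (-z M)\<close> with any solution has
derivative zero, because \<open>exp (-z M)\<close> commutes with \<open>M\<close>.\<close>

lemma mat_exp_minus_mult_solution:
  assumes "\<And>z. has_mat_deriv G (M ** G z) z" "G 0 = mat 1"
  shows "mat_exp ((- z) *\<^sub>M M) ** G z = mat 1"
proof -
  let ?E = "\<lambda>z. mat_exp ((- z) *\<^sub>M M)"
  have comm: "?E z ** M = M ** ?E z" for z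
    by (metis cscale_mult_left cscale_mult_right mat_exp_commute)
  have E: "has_mat_deriv ?E ((- 1) *\<^sub>M (M ** ?E z)) z" for z
    by (rule has_mat_deriv_chain[OF _ has_mat_deriv_mat_exp]) (auto intro!: derivative_eq_intros)
  have "((- 1) *\<^sub>M (M ** ?E z)) ** G z + ?E z ** (M ** G z) = 0" for z
    using comm[of z] by (simp add: cscale_minus_left matrix_mul_assoc matrix_minus_mult_left)
  then have "has_mat_deriv (\<lambda>z. ?E z ** G z) 0 z" for z
    using has_mat_deriv_mult[OF E assms(1), of z] by simp
  then have "\<exists>c. \<forall>z\<in>UNIV. (?E z ** G z) $ i $ j = c" for i j
    by (intro has_field_derivative_zero_constant) (auto simp: has_mat_deriv_def)
  then have "(?E z ** G z) $ i $ j = (?E 0 ** G 0) $ i $ j" for i j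
    by (metis UNIV_I)
  then show ?thesis
    by (simp add: vec_eq_iff assms(2))
qed

text \<open>Both \<open>exp (-z) exp (z (M + I))\<close> and \<open>exp (z M)\<close> solve \<open>G' = M G\<close> with value \<open>I\<close> at the
origin.\<close>

lemma mat_exp_shift: "mat_exp (z *\<^sub>M (M + mat 1)) = exp z *\<^sub>M mat_exp (z *\<^sub>M M)"
proof -
  let ?G = "\<lambda>z. exp (- z) *\<^sub>M mat_exp (z *\<^sub>M (M + mat 1))"
  have "has_mat_deriv ?G ((- exp (- z)) *\<^sub>M mat_exp (z *\<^sub>M (M + mat 1))
      + exp (- z) *\<^sub>M ((M + mat 1) ** mat_exp (z *\<^sub>M (M + mat 1)))) z" for z
    by (rule has_mat_deriv_cscale[OF _ has_mat_deriv_mat_exp]) (auto intro!: derivative_eq_intros)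
  moreover have "(- exp (- z)) *\<^sub>M mat_exp (z *\<^sub>M (M + mat 1))
      + exp (- z) *\<^sub>M ((M + mat 1) ** mat_exp (z *\<^sub>M (M + mat 1))) = M ** ?G z" for z
    by (simp add: matrix_add_rdistrib cscale_add_right cscale_minus_left)
  ultimately have "has_mat_deriv ?G (M ** ?G z) z" for z
    by simp
  from mat_exp_minus_mult_solution[OF this]
  have 1: "mat_exp ((- z) *\<^sub>M M) ** ?G z = mat 1"
    by simp
  have 2: "mat_exp ((- z) *\<^sub>M M) ** mat_exp (z *\<^sub>M M) = mat 1"
    by (rule mat_exp_minus_mult_solution) (auto intro: has_mat_deriv_mat_exp)
  have "?G z = mat_exp (z *\<^sub>M M)"
    using 1 2 invertible_if_mult_eq_1(1) invertible_cancel_left by metis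
  then have "exp z *\<^sub>M ?G z = exp z *\<^sub>M mat_exp (z *\<^sub>M M)"
    by (rule arg_cong)
  then show ?thesis
    by (simp add: exp_minus)
qed

lemma has_mat_deriv_mat_powr:
  assumes "t \<notin> \<real>\<^sub>\<le>\<^sub>0"
  shows "has_mat_deriv (\<lambda>t. mat_powr t M) ((1 / t) *\<^sub>M (M ** mat_powr t M)) t"
  unfolding mat_powr_def
  by (rule has_mat_deriv_chain[OF _ has_mat_deriv_mat_exp])
     (use assms in \<open>auto intro!: derivative_eq_intros simp: inverse_eq_divide\<close>)

lemma mat_powr_commute:
  assumes "X ** M = M ** X"
  shows "X ** mat_powr t M = mat_powr t M ** X"
  unfolding mat_powr_def by (rule mat_exp_commute) (simp add: assms)

lemma mat_powr_add_1: "t \<noteq> 0 \<Longrightarrow> mat_powr t (M + mat 1) = t *\<^sub>M mat_powr t M"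
  by (simp add: mat_powr_def mat_exp_shift)

lemma mat_powr_diff_1: "t \<noteq> 0 \<Longrightarrow> mat_powr t M = t *\<^sub>M mat_powr t (M - mat 1)"
  using mat_powr_add_1[of t "M - mat 1"] by simp

section \<open>Shifts of Pochhammer symbols\<close>

lemma mat_poch_commute:
  assumes "X ** M = M ** X"
  shows "X ** mat_poch M n = mat_poch M n ** X"
proof (induction n)
  case (Suc n)
  have "X ** mat_poch M (Suc n) = (X ** mat_poch M n) ** (M + mat (of_nat n))"
    by (simp add: matrix_mul_assoc)
  also have "\<dots> = mat_poch M n ** (X ** (M + mat (of_nat n)))"
    by (simp only: Suc matrix_mul_assoc)
  also have "X ** (M + mat (of_nat n)) = (M + mat (of_nat n)) ** X"
    by (simp add: matrix_distribs assms)
  finally show ?case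
    by (simp add: matrix_mul_assoc)
qed simp

lemma mat_poch_Suc_left: "mat_poch M (Suc n) = M ** mat_poch (M + mat 1) n"
proof (induction n)
  case (Suc n)
  have "mat_poch M (Suc (Suc n)) = M ** mat_poch (M + mat 1) n ** (M + mat (of_nat (Suc n)))"
    by (subst mat_poch.simps) (simp only: Suc)
  also have "M + mat (of_nat (Suc n)) = M + mat 1 + mat (of_nat n)"
    by (simp add: mat_add[symmetric] add.assoc)
  finally show ?case
    by (simp add: matrix_mul_assoc)
qed simp

lemma mat_poch_Suc_left': "mat_poch M (Suc n) = (M + mat (of_nat n)) ** mat_poch M n"
  by (simp, rule mat_poch_commute[symmetric]) (simp add: matrix_distribs)

lemma invertible_mat_poch:
  assumes "\<And>k. invertible (M + mat (of_nat k))"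
  shows "invertible (mat_poch M n)"
  by (induction n) (auto intro: invertible_mult assms simp: invertible_def[of "mat 1"])

text \<open>The factors of \<open>(I - A)\<^sub>n\<close> are exactly the matrices in this condition, which says that no positive
integer is an eigenvalue of \<open>A\<close>.\<close>

lemma neg_poch_defined_iff:
  "neg_poch_defined A \<longleftrightarrow> (\<forall>k. invertible (mat 1 - A + mat (of_nat k)))"
proof
  assume "neg_poch_defined A"
  then have "invertible (mat_poch (mat 1 - A) (Suc k))" for k
    unfolding neg_poch_defined_def by blast
  then show "\<forall>k. invertible (mat 1 - A + mat (of_nat k))"
    by (auto intro: invertible_mult_right_factor)
qed (auto simp: neg_poch_defined_def intro: invertible_mat_poch)

lemma neg_poch_defined_diff_of_nat:
  assumes "neg_poch_defined A"
  shows "neg_poch_defined (A - mat (of_nat r))"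
proof -
  have "mat 1 - (A - mat (of_nat r)) + mat (of_nat k) = mat 1 - A + mat (of_nat (k + r))" for k
    by (simp add: vec_eq_iff mat_def)
  then show ?thesis
    using assms unfolding neg_poch_defined_iff by metis
qed

lemma neg_poch_defined_add_le:
  assumes "neg_poch_defined (A + mat (of_nat r))" "k \<le> r"
  shows "neg_poch_defined (A + mat (of_nat k))"
proof -
  have "A + mat (of_nat k) = A + mat (of_nat r) - mat (of_nat (r - k))"
    using assms(2) by (simp add: vec_eq_iff mat_def of_nat_diff)
  then show ?thesis
    using neg_poch_defined_diff_of_nat[OF assms(1)] by metis
qed

lemma invertible_add_neg_int:
  assumes "neg_poch_defined A" "k < 0"
  shows "invertible (A + mat (of_int k))"
proof -
  have "of_int k = - (1 + of_nat (nat (- k - 1)) :: complex)"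
    using assms(2) by (simp add: of_nat_nat)
  then have "A + mat (of_int k) = - (mat 1 - A + mat (of_nat (nat (- k - 1))))"
    by (simp add: vec_eq_iff mat_def)
  moreover have "invertible (- (mat 1 - A + mat (of_nat (nat (- k - 1)))))"
    using assms(1) neg_poch_defined_iff invertible_uminus by blast
  ultimately show ?thesis
    by metis
qed

lemma mat_poch_int_of_nat: "mat_poch_int A (int n) = mat_poch A n"
  by (simp add: mat_poch_int_def)

lemma mat_poch_int_neg:
  "mat_poch_int A (- int n) = (-1) ^ n *\<^sub>M matrix_inv (mat_poch (mat 1 - A) n)"
  by (cases "n = 0") (simp_all add: mat_poch_int_def)

lemma mat_poch_int_commute:
  assumes "neg_poch_defined A" "X ** A = A ** X"
  shows "X ** mat_poch_int A k = mat_poch_int A k ** X"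
proof (cases "k \<ge> 0")
  case True
  then show ?thesis
    by (simp add: mat_poch_int_def mat_poch_commute assms)
next
  case False
  have "X ** mat_poch (mat 1 - A) n = mat_poch (mat 1 - A) n ** X" for n
    by (rule mat_poch_commute) (simp add: matrix_distribs assms)
  then have "X ** matrix_inv (mat_poch (mat 1 - A) n) = matrix_inv (mat_poch (mat 1 - A) n) ** X" for n
    using assms(1) matrix_inv_commute unfolding neg_poch_defined_def by metis
  then show ?thesis
    using False by (simp add: mat_poch_int_def)
qed

text \<open>The functional equation of the Pochhammer symbol. It crosses from nonnegative to negative indices without
change, since \<open>I - A + n I = - (A + k I)\<close> for \<open>k = -(n + 1)\<close>.\<close>

lemma mat_poch_int_add_1:
  assumes "neg_poch_defined A"
  shows "mat_poch_int A (k + 1) = mat_poch_int A k ** (A + mat (of_int k))"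
proof (cases k rule: int_cases)
  case (nonneg n)
  have "mat_poch_int A (k + 1) = mat_poch A (Suc n)"
    by (simp add: nonneg mat_poch_int_def nat_add_distrib)
  then show ?thesis
    by (simp add: nonneg mat_poch_int_of_nat)
next
  case (neg n)
  let ?P = "mat_poch (mat 1 - A)" and ?F = "mat 1 - A + mat (of_nat n)"
  have inv: "invertible (?P n)" "invertible ?F"
    using assms neg_poch_defined_iff neg_poch_defined_def by blast+
  have k: "k = - int (Suc n)" "k + 1 = - int n"
    using neg by simp_all
  have F: "A + mat (of_int k) = (-1) *\<^sub>M ?F"
    by (simp add: k vec_eq_iff mat_def)
  have "matrix_inv (?P (Suc n)) ** ?F = matrix_inv (?P n)"
  proof (rule invertible_cancel_left[OF inv(1)])
    have "?P n ** (matrix_inv (?P (Suc n)) ** ?F) = ?P n ** (matrix_inv (?F ** ?P n) ** ?F)"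
      by (simp only: mat_poch_Suc_left')
    also have "\<dots> = ?P n ** matrix_inv (?P n) ** (matrix_inv ?F ** ?F)"
      by (simp add: matrix_inv_mult inv matrix_mul_assoc)
    finally show "?P n ** (matrix_inv (?P (Suc n)) ** ?F) = ?P n ** matrix_inv (?P n)"
      by (simp add: matrix_inv_inverse inv)
  qed
  moreover have "mat_poch_int A k = (-1) ^ Suc n *\<^sub>M matrix_inv (?P (Suc n))"
    by (simp only: k mat_poch_int_neg)
  moreover have "mat_poch_int A (k + 1) = (-1) ^ n *\<^sub>M matrix_inv (?P n)"
    by (simp only: k(2) mat_poch_int_neg)
  ultimately show ?thesis
    unfolding F by simp
qed

text \<open>Both sides obey the same recursion in \<open>k\<close> and agree for \<open>k = 0\<close>. Stepping down requires cancelling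
the factor \<open>A + k I\<close> with \<open>k \<le> 0\<close>; for \<open>k = 0\<close> this is \<open>A\<close> itself, which is
invertible because the symbols of \<open>A + I\<close> are defined.\<close>

lemma mat_poch_int_add_1_left:
  assumes "neg_poch_defined A" "neg_poch_defined (A + mat 1)"
  shows "mat_poch_int A (k + 1) = A ** mat_poch_int (A + mat 1) k"
proof (induction k rule: int_induct[where k=0])
  case base
  show ?case
    by (simp add: mat_poch_int_def)
next
  case (step1 k)
  have "mat_poch_int A (k + 1 + 1) = A ** mat_poch_int (A + mat 1) k ** (A + mat (of_int (k + 1)))"
    using mat_poch_int_add_1[OF assms(1), of "k + 1"] step1 by simp
  also have "A + mat (of_int (k + 1)) = A + mat 1 + mat (of_int k)"
    by (simp add: mat_add)
  finally show ?case
    by (simp only: mat_poch_int_add_1[OF assms(2)] matrix_mul_assoc)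
next
  case (step2 k)
  have eq: "A + mat (of_int k) = A + mat 1 + mat (of_int (k - 1))"
    by (simp add: vec_eq_iff mat_def)
  have "mat_poch_int A k ** (A + mat (of_int k)) = A ** mat_poch_int (A + mat 1) (k - 1 + 1)"
    using mat_poch_int_add_1[OF assms(1), of k] step2 by simp
  also have "\<dots> = A ** mat_poch_int (A + mat 1) (k - 1) ** (A + mat (of_int k))"
    by (simp only: mat_poch_int_add_1[OF assms(2)] matrix_mul_assoc eq)
  finally have *: "mat_poch_int A k ** (A + mat (of_int k))
    = A ** mat_poch_int (A + mat 1) (k - 1) ** (A + mat (of_int k))" .
  have "invertible (A + mat (of_int k))"
    unfolding eq by (rule invertible_add_neg_int) (use step2 assms(2) in auto)
  from this * have "mat_poch_int A k = A ** mat_poch_int (A + mat 1) (k - 1)"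
    by (rule invertible_cancel_right)
  then show ?case
    by simp
qed

lemma matrix_inv_mat_poch_Suc:
  assumes "\<And>k. invertible (C + mat (of_nat k))"
  shows "matrix_inv (mat_poch C (Suc n)) = matrix_inv (mat_poch (C + mat 1) n) ** matrix_inv C"
proof -
  have "invertible C"
    using assms[of 0] by simp
  moreover have "invertible (mat_poch (C + mat 1) n)"
    using assms[of "Suc _"] by (intro invertible_mat_poch) (simp add: mat_add add.assoc)
  ultimately show ?thesis
    by (simp only: mat_poch_Suc_left matrix_inv_mult)
qed

text \<open>Obtained from \<open>(C - I) (C)\<^sub>m = (C - I)\<^sub>m (C - I + m I)\<close>, two ways of reading
\<open>(C - I)\<^bsub>m+1\<^esub>\<close>, by moving the inverses to the other side; all factors commute.\<close>

lemma matrix_inv_mat_poch_shift_down: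
  assumes "\<And>k. invertible (C + mat (of_nat k))" "invertible (C - mat 1)"
  shows "matrix_inv (mat_poch C m) ** (C - mat 1 + mat (of_nat m)) =
    matrix_inv (mat_poch (C - mat 1) m) ** (C - mat 1)"
proof -
  have inv: "invertible (C - mat 1 + mat (of_nat k))" for k
  proof (cases k)
    case (Suc l)
    then have "C - mat 1 + mat (of_nat k) = C + mat (of_nat l)"
      by (simp add: vec_eq_iff mat_def)
    then show ?thesis
      using assms(1) by metis
  qed (use assms(2) in simp)
  have P: "invertible (mat_poch (C - mat 1) m)"
    by (rule invertible_mat_poch) (rule inv)
  have C: "invertible (mat_poch C m)"
    by (rule invertible_mat_poch) (rule assms)
  have "mat_poch (C - mat 1) (Suc m) = (C - mat 1) ** mat_poch C m"
    by (simp only: mat_poch_Suc_left diff_add_cancel)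
  then have "(C - mat 1) ** mat_poch C m = mat_poch (C - mat 1) m ** (C - mat 1 + mat (of_nat m))"
    by simp
  also have "(C - mat 1) ** mat_poch C m = mat_poch C m ** (C - mat 1)"
    by (rule mat_poch_commute) (simp add: matrix_distribs)
  finally have *: "mat_poch C m ** (C - mat 1) = mat_poch (C - mat 1) m ** (C - mat 1 + mat (of_nat m))" .
  have comm: "mat_poch C m ** mat_poch (C - mat 1) m = mat_poch (C - mat 1) m ** mat_poch C m"
  proof (rule mat_poch_commute)
    show "mat_poch C m ** (C - mat 1) = (C - mat 1) ** mat_poch C m"
      by (rule mat_poch_commute[symmetric]) (simp add: matrix_distribs)
  qed
  show ?thesis
  proof (rule invertible_cancel_left[OF P], rule invertible_cancel_left[OF C])
    let ?P = "mat_poch (C - mat 1) m" and ?Q = "mat_poch C m"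
    have "?Q ** (?P ** (matrix_inv ?Q ** (C - mat 1 + mat (of_nat m))))
        = ?P ** (?Q ** matrix_inv ?Q) ** (C - mat 1 + mat (of_nat m))"
      by (simp only: matrix_mul_assoc comm)
    also have "\<dots> = ?Q ** (C - mat 1)"
      by (simp add: matrix_inv_inverse C *)
    also have "\<dots> = ?Q ** (?P ** matrix_inv ?P ** (C - mat 1))"
      by (simp add: matrix_inv_inverse P)
    finally show "?Q ** (?P ** (matrix_inv ?Q ** (C - mat 1 + mat (of_nat m))))
        = ?Q ** (?P ** (matrix_inv ?P ** (C - mat 1)))"
      by (simp only: matrix_mul_assoc)
  qed
qed

section \<open>Growth of the coefficients\<close>

text \<open>For nonnegative \<open>u\<close> this says that the power series with coefficients \<open>u\<close> has radius of
convergence at least one. Polynomial growth, such as that of the quotient of \<open>(B)\<^sub>m\<close> by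
\<open>m!\<close>, is included.\<close>

definition subgeometric :: "(nat \<Rightarrow> real) \<Rightarrow> bool"
  where "subgeometric u \<longleftrightarrow> (\<forall>\<rho>>1. \<exists>K\<ge>0. \<forall>k. u k \<le> K * \<rho> ^ k)"

lemma subgeometric_if_ratio:
  assumes nonneg: "\<And>k. 0 \<le> u k"
    and q: "q \<longlonglongrightarrow> 1"
    and ratio: "\<forall>\<^sub>F k in sequentially. u (Suc k) \<le> q k * u k"
  shows "subgeometric u"
  unfolding subgeometric_def
proof (intro allI impI)
  fix \<rho> :: real
  assume \<rho>: "\<rho> > 1"
  have "\<forall>\<^sub>F k in sequentially. q k < \<rho>"
    using q \<rho> by (rule order_tendstoD)
  with ratio have "\<forall>\<^sub>F k in sequentially. u (Suc k) \<le> \<rho> * u k"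
    by eventually_elim (meson less_imp_le mult_right_mono nonneg order_trans)
  then obtain N where N: "\<And>k. k \<ge> N \<Longrightarrow> u (Suc k) \<le> \<rho> * u k"
    by (auto simp: eventually_sequentially)
  define K where "K = (\<Sum>k\<le>N. u k)"
  have K: "K \<ge> 0"
    by (simp add: K_def sum_nonneg nonneg)
  have small: "u k \<le> K * \<rho> ^ k" if "k \<le> N" for k
  proof -
    have "u k \<le> K"
      unfolding K_def using that nonneg by (intro member_le_sum) auto
    also have "K \<le> K * \<rho> ^ k"
      using K \<rho> by (simp add: mult_le_cancel_left1)
    finally show ?thesis .
  qed
  have "u k \<le> K * \<rho> ^ k" if "k \<ge> N" for k
    using that
  proof (induction k rule: dec_induct)
    case (step k)
    have "u (Suc k) \<le> \<rho> * u k"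
      using N step by simp
    also have "\<dots> \<le> \<rho> * (K * \<rho> ^ k)"
      using step \<rho> by simp
    finally show ?case
      by (simp add: mult_ac)
  qed (use small in simp)
  then show "\<exists>K\<ge>0. \<forall>k. u k \<le> K * \<rho> ^ k"
    using small K by (meson linear)
qed

lemma linear_ratio_tendsto_1: "(\<lambda>m. (real m + a) / (real m + b)) \<longlonglongrightarrow> 1"
proof -
  have lim: "filterlim (\<lambda>m. b + real m) at_top sequentially"
    by (rule filterlim_tendsto_add_at_top[OF tendsto_const filterlim_real_sequentially])
  have "(\<lambda>m. 1 + (a - b) * inverse (b + real m)) \<longlonglongrightarrow> 1 + (a - b) * 0"
    by (intro tendsto_intros tendsto_inverse_0_at_top lim)
  moreover have "\<forall>\<^sub>F m in sequentially. 1 + (a - b) * inverse (b + real m) = (real m + a) / (real m + b)"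
  proof -
    have "\<forall>\<^sub>F m in sequentially. b + real m > 0"
      using lim by (simp add: filterlim_at_top_dense)
    then show ?thesis
      by eventually_elim (simp add: field_simps)
  qed
  ultimately show ?thesis
    using Lim_transform_eventually by force
qed

text \<open>Since \<open>(B)\<^bsub>m+1\<^esub> = (B)\<^sub>m B + m (B)\<^sub>m\<close>, the quotient of consecutive terms is at most
\<open>(m + b) / (m + 1)\<close> for a constant \<open>b\<close>.\<close>

lemma subgeometric_mat_poch: "subgeometric (\<lambda>m. norm (mat_poch B m) / fact m)"
proof -
  obtain K :: real where K: "K > 0"
    and mult: "\<And>(X :: complex^'a^'a) (Y :: complex^'a^'a). norm (X ** Y) \<le> norm X * norm Y * K"
    using norm_matrix_mult_le by blast
  show ?thesis
  proof (rule subgeometric_if_ratio)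
    show "(\<lambda>m. (real m + norm B * K) / (real m + 1)) \<longlonglongrightarrow> 1"
      by (rule linear_ratio_tendsto_1)
    have "norm (mat_poch B (Suc m)) \<le> (real m + norm B * K) * norm (mat_poch B m)" for m
    proof -
      have "norm (mat_poch B (Suc m)) \<le> norm (mat_poch B m ** B) + norm (of_nat m *\<^sub>M mat_poch B m)"
        by (simp add: matrix_add_ldistrib del: norm_cscale) (rule norm_triangle_ineq)
      also have "\<dots> \<le> norm (mat_poch B m) * norm B * K + real m * norm (mat_poch B m)"
        using mult by simp
      finally show ?thesis
        by (simp add: algebra_simps)
    qed
    then show "\<forall>\<^sub>F m in sequentially. norm (mat_poch B (Suc m)) / fact (Suc m)
        \<le> (real m + norm B * K) / (real m + 1) * (norm (mat_poch B m) / fact m)"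
      by (intro always_eventually allI) (simp add: divide_simps mult.commute add.commute)
  qed simp
qed

text \<open>With \<open>X\<^sub>m\<close> the inverse of \<open>(C)\<^sub>m\<close>, the relation \<open>(C + m I) X\<^bsub>m+1\<^esub> = X\<^sub>m\<close> bounds
\<open>m X\<^bsub>m+1\<^esub>\<close> by \<open>X\<^sub>m\<close> and a fixed multiple of \<open>X\<^bsub>m+1\<^esub>\<close>, which is absorbed on the
left once \<open>m\<close> is large.\<close>

lemma subgeometric_matrix_inv_mat_poch:
  assumes "\<And>k. invertible (C + mat (of_nat k))"
  shows "subgeometric (\<lambda>m. fact m * norm (matrix_inv (mat_poch C m)))"
proof -
  obtain K :: real where K: "K > 0"
    and mult: "\<And>(X :: complex^'a^'a) (Y :: complex^'a^'a). norm (X ** Y) \<le> norm X * norm Y * K"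
    using norm_matrix_mult_le by blast
  define c where "c = norm C * K"
  let ?X = "\<lambda>m. matrix_inv (mat_poch C m)"
  show ?thesis
  proof (rule subgeometric_if_ratio)
    show "(\<lambda>m. (real m + 1) / (real m + (- c))) \<longlonglongrightarrow> 1"
      by (rule linear_ratio_tendsto_1)
    have step: "real m * norm (?X (Suc m)) \<le> norm (?X m) + c * norm (?X (Suc m))" for m
    proof -
      have inv: "invertible (mat_poch C m)" "invertible (C + mat (of_nat m))"
        using invertible_mat_poch assms by blast+
      have "?X m = (C + mat (of_nat m)) ** ?X (Suc m)"
        by (simp add: matrix_inv_mult inv matrix_mul_assoc matrix_inv_inverse)
      then have "of_nat m *\<^sub>M ?X (Suc m) = ?X m - C ** ?X (Suc m)"
        by (simp only: matrix_add_rdistrib mat_mult_left add_diff_cancel_left')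
      then have "real m * norm (?X (Suc m)) = norm (?X m - C ** ?X (Suc m))"
        by (metis norm_cscale norm_of_nat)
      also have "\<dots> \<le> norm (?X m) + norm (C ** ?X (Suc m))"
        by (rule norm_triangle_ineq4)
      also have "norm (C ** ?X (Suc m)) \<le> c * norm (?X (Suc m))"
        using mult[of C "?X (Suc m)"] by (simp add: c_def mult_ac)
      finally show ?thesis by simp
    qed
    obtain N :: nat where N: "c < real N"
      using reals_Archimedean2 by blast
    have "fact (Suc m) * norm (?X (Suc m)) \<le> (real m + 1) / (real m + (- c)) * (fact m * norm (?X m))"
      if "m \<ge> N" for m
    proof -
      have pos: "real m - c > 0"
        using that N by linarith
      have "norm (?X (Suc m)) \<le> norm (?X m) / (real m - c)"
        using step[of m] pos by (simp add: pos_le_divide_eq algebra_simps)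
      then have "fact (Suc m) * norm (?X (Suc m)) \<le> fact (Suc m) * (norm (?X m) / (real m - c))"
        by (intro mult_left_mono) auto
      then show ?thesis
        by (simp add: algebra_simps del: mat_poch.simps)
    qed
    then show "\<forall>\<^sub>F m in sequentially. fact (Suc m) * norm (?X (Suc m))
        \<le> (real m + 1) / (real m + (- c)) * (fact m * norm (?X m))"
      by (auto simp: eventually_sequentially simp del: mat_poch.simps)
  qed simp
qed

lemma fact_quotient_le:
  assumes "n \<le> m"
  shows "fact (m - n) / fact m \<le> (1 / fact n :: real)"
proof -
  have "fact n * fact (m - n) \<le> (fact m :: nat)"
    using fact_fact_dvd_fact[of n "m - n", where 'a=nat] assms by (intro dvd_imp_le) auto
  then have "fact n * fact (m - n) \<le> (fact m :: real)"
    by (metis of_nat_fact of_nat_le_iff of_nat_mult)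
  then show ?thesis
    by (simp add: divide_simps mult.commute)
qed

lemma fact_product_ge:
  assumes "m \<le> n"
  shows "1 / (fact (n - m) * fact m) \<le> (2 ^ n / fact n :: real)"
proof -
  have "(1 :: real) / (fact (n - m) * fact m) = real (n choose m) / fact n"
    using binomial_fact[OF assms, where 'a=real] by (simp add: field_simps)
  also have "\<dots> \<le> 2 ^ n / fact n"
    using binomial_le_pow2[of n m] by (intro divide_right_mono) (auto simp flip: of_nat_le_iff)
  finally show ?thesis .
qed

text \<open>The symbol \<open>(A)\<^bsub>m-n\<^esub>\<close> behaves like \<open>(m - n)!\<close> for \<open>n \<le> m\<close> and like
\<open>1 / (n - m)!\<close> otherwise. Divided by \<open>m!\<close>, both are at most \<open>2\<^sup>n / n!\<close>: the quotient
\<open>m! / (m - n)!\<close> is at least \<open>n!\<close>, and \<open>n! / ((n - m)! m!)\<close> is a binomial coefficient. This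
factor \<open>1 / n!\<close> makes the double series entire in \<open>y\<close>.\<close>

lemma mat_poch_int_growth:
  assumes "neg_poch_defined A" "\<rho> > 1"
  obtains K where "K \<ge> 0"
    and "\<And>m n. norm (mat_poch_int A (int m - int n)) / fact m \<le> K * \<rho> ^ (m + n) * 2 ^ n / fact n"
proof -
  obtain K1 where K1: "K1 \<ge> 0" "\<And>k. norm (mat_poch A k) / fact k \<le> K1 * \<rho> ^ k"
    using subgeometric_mat_poch[of A] assms(2) unfolding subgeometric_def by blast
  have "subgeometric (\<lambda>k. fact k * norm (matrix_inv (mat_poch (mat 1 - A) k)))"
    using assms(1) by (intro subgeometric_matrix_inv_mat_poch) (simp add: neg_poch_defined_iff)
  then obtain K2 where K2: "K2 \<ge> 0"
    "\<And>k. fact k * norm (matrix_inv (mat_poch (mat 1 - A) k)) \<le> K2 * \<rho> ^ k"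
    using assms(2) unfolding subgeometric_def by blast
  have "norm (mat_poch_int A (int m - int n)) / fact m \<le> (K1 + K2) * \<rho> ^ (m + n) * 2 ^ n / fact n" for m n
  proof (cases "n \<le> m")
    case True
    have "norm (mat_poch_int A (int m - int n)) / fact m
        = norm (mat_poch A (m - n)) / fact (m - n) * (fact (m - n) / fact m)"
      using True by (simp add: mat_poch_int_of_nat flip: of_nat_diff)
    also have "\<dots> \<le> ((K1 + K2) * \<rho> ^ (m + n)) * (2 ^ n / fact n)"
    proof (rule mult_mono)
      have "norm (mat_poch A (m - n)) / fact (m - n) \<le> K1 * \<rho> ^ (m - n)"
        by (rule K1)
      also have "\<dots> \<le> (K1 + K2) * \<rho> ^ (m + n)"
        using K1 K2 assms(2) by (intro mult_mono power_increasing) auto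
      finally show "norm (mat_poch A (m - n)) / fact (m - n) \<le> (K1 + K2) * \<rho> ^ (m + n)" .
      have "fact (m - n) / fact m \<le> (1 / fact n :: real)"
        by (rule fact_quotient_le[OF True])
      also have "\<dots> \<le> 2 ^ n / fact n"
        by (intro divide_right_mono) auto
      finally show "fact (m - n) / fact m \<le> (2 ^ n / fact n :: real)" .
    qed (use K1 K2 assms(2) in auto)
    finally show ?thesis by simp
  next
    case False
    let ?X = "matrix_inv (mat_poch (mat 1 - A) (n - m))"
    have "int m - int n = - int (n - m)"
      using False by simp
    then have "norm (mat_poch_int A (int m - int n)) = norm ?X"
      by (simp only: mat_poch_int_neg norm_cscale) (simp add: norm_power)
    then have "norm (mat_poch_int A (int m - int n)) / fact m
        = (fact (n - m) * norm ?X) * (1 / (fact (n - m) * fact m))"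
      by simp
    also have "\<dots> \<le> ((K1 + K2) * \<rho> ^ (m + n)) * (2 ^ n / fact n)"
    proof (rule mult_mono)
      have "fact (n - m) * norm ?X \<le> K2 * \<rho> ^ (n - m)"
        by (rule K2)
      also have "\<dots> \<le> (K1 + K2) * \<rho> ^ (m + n)"
        using K1 K2 assms(2) by (intro mult_mono power_increasing) auto
      finally show "fact (n - m) * norm ?X \<le> (K1 + K2) * \<rho> ^ (m + n)" .
      show "1 / (fact (n - m) * fact m) \<le> (2 ^ n / fact n :: real)"
        by (rule fact_product_ge) (use False in simp)
    qed (use K1 K2 assms(2) in auto)
    finally show ?thesis by simp
  qed
  then show thesis
    using that K1(1) K2(1) by (metis add_nonneg_nonneg)
qed

definition h2_coeff ::
  "complex^'d^'d \<Rightarrow> complex^'d^'d \<Rightarrow> complex^'d^'d \<Rightarrow> complex^'d^'d \<Rightarrow> nat \<Rightarrow> nat \<Rightarrow> complex^'d^'d"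
  where "h2_coeff A B B' C m n = (1 / (fact m * fact n)) *\<^sub>M
    (mat_poch_int A (int m - int n) ** mat_poch B m ** mat_poch B' n ** matrix_inv (mat_poch C m))"

text \<open>The decay of the coefficients of a double power series that converges for all \<open>x\<close> with \<open>\<bar>x\<bar> < 1\<close>
and all \<open>y\<close>. The base \<open>L\<close> may depend on \<open>\<rho>\<close>, which does no harm against \<open>n!\<close>.\<close>

definition h2_growth :: "(nat \<Rightarrow> nat \<Rightarrow> 'a::real_normed_vector) \<Rightarrow> bool"
  where "h2_growth c \<longleftrightarrow> (\<forall>\<rho>>1. \<exists>K L. K \<ge> 0 \<and> L \<ge> 0 \<and>
    (\<forall>m n. norm (c m n) \<le> K * \<rho> ^ m * L ^ n / fact n))"

lemma h2_growth_h2_coeff: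
  assumes "neg_poch_defined A" "\<And>k. invertible (C + mat (of_nat k))"
  shows "h2_growth (h2_coeff A B B' C)"
  unfolding h2_growth_def
proof (intro allI impI)
  fix \<rho> :: real
  assume "\<rho> > 1"
  (* Each of (A)_(m-n), (B)_m and the inverse of (C)_m contributes one factor of the m-th power. *)
  define \<sigma> where "\<sigma> = root 3 \<rho>"
  have \<sigma>: "\<sigma> > 1" "\<sigma> ^ 3 = \<rho>"
    using \<open>\<rho> > 1\<close> by (simp_all add: \<sigma>_def)
  obtain K :: real where K: "K > 0"
    and mult: "\<And>(X :: complex^'a^'a) (Y :: complex^'a^'a). norm (X ** Y) \<le> norm X * norm Y * K"
    using norm_matrix_mult_le by blast
  obtain KA where KA: "KA \<ge> 0"
    "\<And>m n. norm (mat_poch_int A (int m - int n)) / fact m \<le> KA * \<sigma> ^ (m + n) * 2 ^ n / fact n"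
    using mat_poch_int_growth[OF assms(1) \<sigma>(1)] by blast
  obtain KB where KB: "KB \<ge> 0" "\<And>k. norm (mat_poch B k) / fact k \<le> KB * \<sigma> ^ k"
    using subgeometric_mat_poch[of B] \<sigma>(1) unfolding subgeometric_def by blast
  obtain KB' where KB': "KB' \<ge> 0" "\<And>k. norm (mat_poch B' k) / fact k \<le> KB' * \<sigma> ^ k"
    using subgeometric_mat_poch[of B'] \<sigma>(1) unfolding subgeometric_def by blast
  obtain KC where KC: "KC \<ge> 0" "\<And>k. fact k * norm (matrix_inv (mat_poch C k)) \<le> KC * \<sigma> ^ k"
    using subgeometric_matrix_inv_mat_poch[OF assms(2)] \<sigma>(1) unfolding subgeometric_def by blast
  have mult4: "norm (X ** Y ** Z ** W) \<le> norm X * norm Y * norm Z * norm W * K ^ 3"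
    for X Y Z W :: "complex^'a^'a"
  proof -
    have "norm (X ** Y ** Z ** W) \<le> norm (X ** Y ** Z) * norm W * K"
      by (rule mult)
    also have "\<dots> \<le> (norm (X ** Y) * norm Z * K) * norm W * K"
      using mult K by (intro mult_right_mono) auto
    also have "\<dots> \<le> (norm X * norm Y * K * norm Z * K) * norm W * K"
      using mult K by (intro mult_right_mono) auto
    finally show ?thesis
      by (simp add: power3_eq_cube mult_ac)
  qed
  have "norm (h2_coeff A B B' C m n) \<le> (K ^ 3 * KA * KB * KB' * KC) * \<rho> ^ m * (2 * \<sigma>\<^sup>2) ^ n / fact n" for m n
  proof -
    let ?A = "norm (mat_poch_int A (int m - int n))" and ?B = "norm (mat_poch B m)"
      and ?B' = "norm (mat_poch B' n)" and ?C = "norm (matrix_inv (mat_poch C m))"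
    have "norm (h2_coeff A B B' C m n) \<le> 1 / (fact m * fact n) * (?A * ?B * ?B' * ?C * K ^ 3)"
      unfolding h2_coeff_def norm_cscale
      by (intro mult_mono mult4) (auto simp: norm_divide norm_mult)
    also have "\<dots> = K ^ 3 * (((?A / fact m) * (?B / fact m)) * ((?B' / fact n) * (fact m * ?C)))"
      by (simp add: field_simps)
    also have "\<dots> \<le> K ^ 3 * (((KA * \<sigma> ^ (m + n) * 2 ^ n / fact n) * (KB * \<sigma> ^ m))
        * ((KB' * \<sigma> ^ n) * (KC * \<sigma> ^ m)))"
      using K \<sigma>(1) KA(1) KB(1) KB'(1) KC(1)
      by (intro mult_left_mono mult_mono KA(2) KB(2) KB'(2) KC(2)) auto
    also have "\<dots> = (K ^ 3 * KA * KB * KB' * KC) * (\<sigma> ^ 3) ^ m * (2 * \<sigma>\<^sup>2) ^ n / fact n"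
      by (simp add: power_add power_mult_distrib power2_eq_square power3_eq_cube mult_ac)
    finally show ?thesis
      by (simp add: \<sigma>(2))
  qed
  moreover have "K ^ 3 * KA * KB * KB' * KC \<ge> 0" "2 * \<sigma>\<^sup>2 \<ge> 0"
    using K KA(1) KB(1) KB'(1) KC(1) by simp_all
  ultimately show "\<exists>K L. K \<ge> 0 \<and> L \<ge> 0 \<and>
      (\<forall>m n. norm (h2_coeff A B B' C m n) \<le> K * \<rho> ^ m * L ^ n / fact n)"
    by blast
qed

section \<open>Termwise differentiation of the double series\<close>

text \<open>Choosing \<open>\<rho> > 1\<close> with \<open>\<rho> s < 1\<close> gives the product of a geometric and an exponential series.\<close>

lemma h2_growth_majorant:
  fixes c :: "nat \<Rightarrow> nat \<Rightarrow> 'a::real_normed_vector"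
  assumes "h2_growth c" "0 \<le> s" "s < 1" "0 \<le> R"
  obtains M :: "nat \<times> nat \<Rightarrow> real" where "M summable_on UNIV"
    and "\<And>m n. norm (c m n) * (s ^ m * R ^ n) \<le> M (m, n)"
proof -
  define \<rho> where "\<rho> = 2 / (1 + s)"
  have \<rho>: "\<rho> > 1" "\<rho> * s < 1" "\<rho> * s \<ge> 0"
    using assms(2,3) by (simp_all add: \<rho>_def field_simps)
  obtain K L where KL: "K \<ge> 0" "L \<ge> 0" "\<And>m n. norm (c m n) \<le> K * \<rho> ^ m * L ^ n / fact n"
    using assms(1) \<rho>(1) unfolding h2_growth_def by blast
  define M where "M = (\<lambda>(m, n). K * (\<rho> * s) ^ m * ((L * R) ^ n / fact n))"
  have "M summable_on (SIGMA m:UNIV. UNIV)"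
  proof (rule summable_on_SigmaI)
    fix m :: nat
    have "((\<lambda>n. (L * R) ^ n / fact n) has_sum exp (L * R)) UNIV"
      using exp_converges[of "L * R"] KL(2) assms(4)
      by (intro sums_nonneg_imp_has_sum) (auto simp: divide_inverse mult.commute)
    from has_sum_cmult_right[OF this, of "K * (\<rho> * s) ^ m"]
    show "((\<lambda>n. M (m, n)) has_sum (K * (\<rho> * s) ^ m * exp (L * R))) UNIV"
      by (simp add: M_def)
  next
    have "(\<lambda>m. (\<rho> * s) ^ m) summable_on UNIV"
      using \<rho> by (intro norm_summable_imp_summable_on) (simp add: norm_power)
    then show "(\<lambda>m. K * (\<rho> * s) ^ m * exp (L * R)) summable_on UNIV"
      by (intro summable_on_cmult_left summable_on_cmult_right)
  next
    show "M (m, n) \<ge> 0" for m n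
      using KL(1,2) \<rho>(3) assms(4) by (simp add: M_def)
  qed
  moreover have "norm (c m n) * (s ^ m * R ^ n) \<le> M (m, n)" for m n
  proof -
    have "norm (c m n) * (s ^ m * R ^ n) \<le> K * \<rho> ^ m * L ^ n / fact n * (s ^ m * R ^ n)"
      using assms(2,4) by (intro mult_right_mono KL(3)) auto
    then show ?thesis
      by (simp add: M_def power_mult_distrib mult_ac)
  qed
  ultimately show thesis
    using that by simp
qed

lemma h2_growth_nth_nth:
  assumes "h2_growth (c :: nat \<Rightarrow> nat \<Rightarrow> complex^'d^'d)"
  shows "h2_growth (\<lambda>m n. c m n $ i $ j)"
  using assms unfolding h2_growth_def by (meson norm_nth_nth_le order_trans)

text \<open>The substitutions \<open>(u, v) = (t, y)\<close>, \<open>(x, t)\<close> and \<open>(t, y / t)\<close> are the three ways in which a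
single variable is singled out below, so the series is differentiated along an arbitrary holomorphic curve
\<open>(u, v)\<close>. On a compact disc \<open>\<bar>u\<bar>\<close> and \<open>\<bar>v\<bar>\<close> attain their maxima, so the majorant at these
maxima gives uniform convergence of the partial sums over finite index sets; by the theorem of Weierstrass the
derivatives then converge to the derivative of the limit.\<close>

lemma double_series_has_field_derivative:
  fixes c :: "nat \<Rightarrow> nat \<Rightarrow> complex"
  assumes growth: "h2_growth c" and S: "open S" "t \<in> S"
    and u: "\<And>z. z \<in> S \<Longrightarrow> (u has_field_derivative u' z) (at z)" "\<And>z. z \<in> S \<Longrightarrow> norm (u z) < 1"
    and v: "\<And>z. z \<in> S \<Longrightarrow> (v has_field_derivative v' z) (at z)"
  obtains D where
    "((\<lambda>(m, n). (of_nat m * u t ^ (m - 1) * u' t * v t ^ n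
        + u t ^ m * (of_nat n * v t ^ (n - 1) * v' t)) * c m n) has_sum D) UNIV"
    "((\<lambda>z. \<Sum>\<^sub>\<infinity>(m, n). (u z ^ m * v z ^ n) * c m n) has_field_derivative D) (at t)"
proof -
  obtain e where e: "e > 0" "cball t e \<subseteq> S"
    using S open_contains_cball by blast
  have cont: "continuous_on (cball t e) u" "continuous_on (cball t e) v"
    using DERIV_isCont[OF u(1)] DERIV_isCont[OF v] e(2)
    by (auto intro!: continuous_at_imp_continuous_on)
  have ne: "cball t e \<noteq> {}"
    using e(1) by simp
  obtain t0 where t0: "t0 \<in> cball t e" "\<And>z. z \<in> cball t e \<Longrightarrow> norm (u z) \<le> norm (u t0)"
    using continuous_attains_sup[OF compact_cball ne continuous_on_norm[OF cont(1)]] by blast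
  obtain t1 where t1: "\<And>z. z \<in> cball t e \<Longrightarrow> norm (v z) \<le> norm (v t1)"
    using continuous_attains_sup[OF compact_cball ne continuous_on_norm[OF cont(2)]] by blast
  have "norm (u t0) < 1"
    using t0(1) e(2) u(2) by blast
  then obtain M where M: "M summable_on UNIV"
    "\<And>m n. norm (c m n) * (norm (u t0) ^ m * norm (v t1) ^ n) \<le> M (m, n)"
    using h2_growth_majorant[OF growth] by (metis norm_ge_zero)
  define f where "f = (\<lambda>(m, n) z. (u z ^ m * v z ^ n) * c m n)"
  define f' where "f' = (\<lambda>(m, n) z. (of_nat m * u z ^ (m - 1) * u' z * v z ^ n
        + u z ^ m * (of_nat n * v z ^ (n - 1) * v' z)) * c m n)"
  have bound: "norm (f p z) \<le> M p" if "z \<in> cball t e" for p z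
  proof -
    obtain m n where p: "p = (m, n)"
      by fastforce
    have "norm (f p z) = norm (c m n) * (norm (u z) ^ m * norm (v z) ^ n)"
      by (simp add: p f_def norm_mult norm_power)
    also have "\<dots> \<le> norm (c m n) * (norm (u t0) ^ m * norm (v t1) ^ n)"
      using that t0(2) t1 by (intro mult_left_mono mult_mono power_mono) auto
    finally show ?thesis
      using M(2) p by (meson order_trans)
  qed
  have deriv: "(f p has_field_derivative f' p z) (at z)" if "z \<in> S" for p z
    using u(1)[OF that] v[OF that]
    by (cases p) (auto simp: f_def f'_def intro!: derivative_eq_intros)
  have lim: "uniform_limit (cball t e) (\<lambda>X z. \<Sum>p\<in>X. f p z) (\<lambda>z. \<Sum>\<^sub>\<infinity>p. f p z) (finite_subsets_at_top UNIV)"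
    using Weierstrass_m_test_general[of UNIV "cball t e" f M] bound M(1) by blast
  have partial: "\<forall>\<^sub>F X in finite_subsets_at_top UNIV. continuous_on (cball t e) (\<lambda>z. \<Sum>p\<in>X. f p z) \<and>
      (\<forall>w\<in>ball t e. ((\<lambda>z. \<Sum>p\<in>X. f p z) has_field_derivative (\<Sum>p\<in>X. f' p w)) (at w))"
  proof (intro always_eventually allI conjI ballI)
    show "continuous_on (cball t e) (\<lambda>z. \<Sum>p\<in>X. f p z)" for X
      unfolding f_def case_prod_unfold by (intro continuous_intros cont)
    show "((\<lambda>z. \<Sum>p\<in>X. f p z) has_field_derivative (\<Sum>p\<in>X. f' p w)) (at w)" if "w \<in> ball t e" for X w
      using that e(2) by (intro DERIV_sum deriv) auto
  qed
  obtain g' where g': "\<And>w. w \<in> ball t e \<Longrightarrow>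
      ((\<lambda>z. \<Sum>\<^sub>\<infinity>p. f p z) has_field_derivative g' w) (at w) \<and>
      ((\<lambda>X. \<Sum>p\<in>X. f' p w) \<longlongrightarrow> g' w) (finite_subsets_at_top UNIV)"
    using has_complex_derivative_uniform_limit[OF partial lim finite_subsets_at_top_neq_bot e(1)]
    by blast
  have "((\<lambda>z. \<Sum>\<^sub>\<infinity>p. f p z) has_field_derivative g' t) (at t)" "((\<lambda>p. f' p t) has_sum g' t) UNIV"
    using g'[of t] e(1) by (auto simp: has_sum_def)
  then show thesis
    using that[of "g' t"] by (simp add: f_def f'_def case_prod_unfold)
qed

lemma has_sum_nth_nth:
  fixes f :: "'a \<Rightarrow> complex^'d^'d"
  shows "(f has_sum S) X \<longleftrightarrow> (\<forall>i j. ((\<lambda>x. f x $ i $ j) has_sum S $ i $ j) X)"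
proof
  assume "(f has_sum S) X"
  moreover have "bounded_linear (\<lambda>M :: complex^'d^'d. M $ i $ j)" for i j
    by (rule bounded_linear_compose[OF bounded_linear_vec_nth bounded_linear_vec_nth])
  ultimately show "\<forall>i j. ((\<lambda>x. f x $ i $ j) has_sum S $ i $ j) X"
    using has_sum_bounded_linear by blast
next
  assume "\<forall>i j. ((\<lambda>x. f x $ i $ j) has_sum S $ i $ j) X"
  then show "(f has_sum S) X"
    unfolding has_sum_def by (intro vec_tendstoI) simp
qed

lemma horn_H2_eq: "horn_H2 A B B' C x y = (\<Sum>\<^sub>\<infinity>(m, n). (x ^ m * y ^ n) *\<^sub>M h2_coeff A B B' C m n)"
  unfolding horn_H2_def h2_coeff_def by simp

lemma horn_H2_has_sum:
  assumes "neg_poch_defined A" "\<And>k. invertible (C + mat (of_nat k))" "norm x < 1"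
  shows "((\<lambda>(m, n). (x ^ m * y ^ n) *\<^sub>M h2_coeff A B B' C m n) has_sum horn_H2 A B B' C x y) UNIV"
proof -
  let ?f = "\<lambda>(m, n). (x ^ m * y ^ n) *\<^sub>M h2_coeff A B B' C m n"
  obtain M where M: "M summable_on UNIV"
    "\<And>m n. norm (h2_coeff A B B' C m n) * (norm x ^ m * norm y ^ n) \<le> M (m, n)"
    using h2_growth_majorant[OF h2_growth_h2_coeff[OF assms(1,2)] norm_ge_zero assms(3) norm_ge_zero] by blast
  have "norm (?f p) \<le> M p" for p
    using M(2) by (cases p) (simp add: norm_mult norm_power mult.commute)
  then have "?f summable_on UNIV"
    by (rule abs_summable_summable[OF Infinite_Sum.abs_summable_on_comparison_test'[OF M(1)]])
  then show ?thesis
    unfolding horn_H2_eq by (rule has_sum_infsum)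
qed

lemma horn_H2_has_mat_deriv:
  assumes "neg_poch_defined A" "\<And>k. invertible (C + mat (of_nat k))" and S: "open S" "t \<in> S"
    and u: "\<And>z. z \<in> S \<Longrightarrow> (u has_field_derivative u' z) (at z)" "\<And>z. z \<in> S \<Longrightarrow> norm (u z) < 1"
    and v: "\<And>z. z \<in> S \<Longrightarrow> (v has_field_derivative v' z) (at z)"
  obtains D where "has_mat_deriv (\<lambda>z. horn_H2 A B B' C (u z) (v z)) D t"
    and "((\<lambda>(m, n). (of_nat m * u t ^ (m - 1) * u' t * v t ^ n
        + u t ^ m * (of_nat n * v t ^ (n - 1) * v' t)) *\<^sub>M h2_coeff A B B' C m n) has_sum D) UNIV"
proof -
  let ?c = "h2_coeff A B B' C"
  let ?p = "\<lambda>m n. of_nat m * u t ^ (m - 1) * u' t * v t ^ n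
        + u t ^ m * (of_nat n * v t ^ (n - 1) * v' t)"
  let ?Q = "\<lambda>i j d. ((\<lambda>(m, n). ?p m n * ?c m n $ i $ j) has_sum d) UNIV \<and>
      ((\<lambda>z. \<Sum>\<^sub>\<infinity>(m, n). (u z ^ m * v z ^ n) * ?c m n $ i $ j) has_field_derivative d) (at t)"
  have "\<exists>d. ?Q i j d" for i j
    by (rule double_series_has_field_derivative[OF h2_growth_nth_nth[OF h2_growth_h2_coeff[OF assms(1,2)]]
          S u v]) (assumption+, blast)
  then have "?Q i j (SOME d. ?Q i j d)" for i j
    by (rule someI_ex)
  then obtain D where "\<And>i j. ?Q i j (D i j)"
    by (rule that)
  then have D: "\<And>i j. ((\<lambda>(m, n). ?p m n * ?c m n $ i $ j) has_sum D i j) UNIV"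
    "\<And>i j. ((\<lambda>z. \<Sum>\<^sub>\<infinity>(m, n). (u z ^ m * v z ^ n) * ?c m n $ i $ j) has_field_derivative D i j) (at t)"
    by blast+
  have eq: "(\<Sum>\<^sub>\<infinity>(m, n). (u z ^ m * v z ^ n) * ?c m n $ i $ j) = horn_H2 A B B' C (u z) (v z) $ i $ j"
    if "z \<in> S" for z i j
    using horn_H2_has_sum[OF assms(1,2) u(2)[OF that], of "v z" B B']
    by (intro infsumI) (simp add: has_sum_nth_nth case_prod_unfold)
  have "((\<lambda>z. horn_H2 A B B' C (u z) (v z) $ i $ j) has_field_derivative D i j) (at t)" for i j
    using D(2) S by (rule has_field_derivative_transform_within_open) (rule eq)
  then have "has_mat_deriv (\<lambda>z. horn_H2 A B B' C (u z) (v z)) (\<chi> i j. D i j) t"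
    by (simp add: has_mat_deriv_def)
  moreover have "((\<lambda>(m, n). ?p m n *\<^sub>M ?c m n) has_sum (\<chi> i j. D i j)) UNIV"
    using D(1) by (simp add: has_sum_nth_nth case_prod_unfold)
  ultimately show thesis
    by (rule that)
qed

section \<open>Contiguity relations for the coefficients\<close>

text \<open>In each of the four \<open>euler\<close> relations a scalar \<open>e\<close>, the exponent of the monomial that belongs to the
coefficient in one of the variables, is multiplied to the coefficient: this is the effect of an Euler operator
such as \<open>x d/dx\<close>. Adding the matrix parameter completes a factor like \<open>A + (m - n) I\<close>, which raises
the index of one Pochhammer symbol, and pulling out its first factor instead of its last one shifts the
parameter; for \<open>C\<close> the same happens in the denominator. The commutation hypotheses let the parameter
reach its symbol and the first factor leave the product.\<close>

lemma h2_coeff_euler_A: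
  assumes "neg_poch_defined A" "neg_poch_defined (A + mat 1)"
  shows "A ** h2_coeff A B B' C m n + (of_nat m - of_nat n) *\<^sub>M h2_coeff A B B' C m n =
    A ** h2_coeff (A + mat 1) B B' C m n"
proof -
  let ?k = "int m - int n"
  have "A ** mat_poch_int A ?k + of_int ?k *\<^sub>M mat_poch_int A ?k
      = mat_poch_int A ?k ** (A + mat (of_int ?k))"
    using mat_poch_int_commute[OF assms(1) refl] by (simp only: matrix_add_ldistrib mat_mult_right)
  also have "\<dots> = A ** mat_poch_int (A + mat 1) ?k"
    using mat_poch_int_add_1 mat_poch_int_add_1_left assms by metis
  finally have "(1 / (fact m * fact n)) *\<^sub>M
        ((A ** mat_poch_int A ?k + of_int ?k *\<^sub>M mat_poch_int A ?k) ** X)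
      = (1 / (fact m * fact n)) *\<^sub>M (A ** mat_poch_int (A + mat 1) ?k ** X)" for X
    by simp
  from this[of "mat_poch B m ** (mat_poch B' n ** matrix_inv (mat_poch C m))"] show ?thesis
    by (simp add: h2_coeff_def matrix_mul_assoc[symmetric] matrix_add_rdistrib cscale_add_right)
qed

lemma h2_coeff_euler_B:
  assumes "neg_poch_defined A" "A ** B = B ** A"
  shows "B ** h2_coeff A B B' C m n + of_nat m *\<^sub>M h2_coeff A B B' C m n =
    B ** h2_coeff A (B + mat 1) B' C m n"
proof -
  have comm: "B ** (mat_poch_int A k ** X) = mat_poch_int A k ** (B ** X)" for k X
    by (simp add: matrix_mul_assoc mat_poch_int_commute assms)
  have "B ** mat_poch B m + of_nat m *\<^sub>M mat_poch B m = (B + mat (of_nat m)) ** mat_poch B m"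
    by (simp add: matrix_distribs)
  also have "\<dots> = B ** mat_poch (B + mat 1) m"
    by (metis mat_poch_Suc_left mat_poch_Suc_left')
  finally have "(1 / (fact m * fact n)) *\<^sub>M
        (mat_poch_int A k ** ((B ** mat_poch B m + of_nat m *\<^sub>M mat_poch B m) ** X))
      = (1 / (fact m * fact n)) *\<^sub>M (mat_poch_int A k ** ((B ** mat_poch (B + mat 1) m) ** X))" for k X
    by simp
  from this[of "int m - int n" "mat_poch B' n ** matrix_inv (mat_poch C m)"] show ?thesis
    by (simp add: h2_coeff_def matrix_mul_assoc[symmetric] comm matrix_distribs cscale_add_right)
qed

lemma mat_poch_inv_commute:
  assumes "\<And>k. invertible (C + mat (of_nat k))" "C ** X = X ** C"
  shows "matrix_inv (mat_poch C m) ** X = X ** matrix_inv (mat_poch C m)"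
  by (intro matrix_inv_commute invertible_mat_poch assms mat_poch_commute[symmetric]) (simp add: assms)

lemma h2_coeff_euler_B':
  assumes "\<And>k. invertible (C + mat (of_nat k))" "C ** B' = B' ** C"
  shows "h2_coeff A B B' C m n ** B' + of_nat n *\<^sub>M h2_coeff A B B' C m n =
    h2_coeff A B (B' + mat 1) C m n ** B'"
proof -
  note comm = mat_poch_inv_commute[OF assms]
  have "mat_poch B' n ** B' + of_nat n *\<^sub>M mat_poch B' n = mat_poch B' (Suc n)"
    by (simp add: matrix_distribs)
  also have "\<dots> = B' ** mat_poch (B' + mat 1) n"
    by (rule mat_poch_Suc_left)
  also have "\<dots> = mat_poch (B' + mat 1) n ** B'"
    by (rule mat_poch_commute) (simp add: matrix_distribs)
  finally have "(1 / (fact m * fact n)) *\<^sub>M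
        (X ** ((mat_poch B' n ** B' + of_nat n *\<^sub>M mat_poch B' n) ** Y))
      = (1 / (fact m * fact n)) *\<^sub>M (X ** ((mat_poch (B' + mat 1) n ** B') ** Y))" for X Y
    by simp
  from this[of "mat_poch_int A (int m - int n) ** mat_poch B m" "matrix_inv (mat_poch C m)"]
  show ?thesis
    by (simp add: h2_coeff_def matrix_mul_assoc[symmetric] comm matrix_distribs cscale_add_right)
qed

lemma h2_coeff_euler_C:
  assumes "\<And>k. invertible (C + mat (of_nat k))" "invertible (C - mat 1)"
  shows "h2_coeff A B B' C m n ** (C - mat 1) + of_nat m *\<^sub>M h2_coeff A B B' C m n =
    h2_coeff A B B' (C - mat 1) m n ** (C - mat 1)"
proof -
  let ?X = "mat_poch_int A (int m - int n) ** mat_poch B m ** mat_poch B' n"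
  have "h2_coeff A B B' C m n ** (C - mat 1) + of_nat m *\<^sub>M h2_coeff A B B' C m n
      = h2_coeff A B B' C m n ** (C - mat 1 + mat (of_nat m))"
    by (simp only: matrix_add_ldistrib mat_mult_right)
  also have "\<dots> = (1 / (fact m * fact n)) *\<^sub>M
      (?X ** (matrix_inv (mat_poch C m) ** (C - mat 1 + mat (of_nat m))))"
    by (simp only: h2_coeff_def cscale_mult_left matrix_mul_assoc)
  also have "\<dots> = h2_coeff A B B' (C - mat 1) m n ** (C - mat 1)"
    unfolding matrix_inv_mat_poch_shift_down[OF assms]
    by (simp only: h2_coeff_def cscale_mult_left matrix_mul_assoc)
  finally show ?thesis .
qed

text \<open>The coefficient relations behind the plain derivatives, where the index moves by one and the factorial absorbs
the exponent.\<close>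

lemma h2_coeff_shift_m:
  assumes "neg_poch_defined A" "neg_poch_defined (A + mat 1)" "A ** B = B ** A"
    and "\<And>k. invertible (C + mat (of_nat k))"
  shows "of_nat (Suc m) *\<^sub>M h2_coeff A B B' C (Suc m) n =
    A ** B ** h2_coeff (A + mat 1) (B + mat 1) B' (C + mat 1) m n ** matrix_inv C"
proof -
  have "int (Suc m) - int n = int m - int n + 1"
    by simp
  then have P: "mat_poch_int A (int (Suc m) - int n) = A ** mat_poch_int (A + mat 1) (int m - int n)"
    using mat_poch_int_add_1_left[OF assms(1,2)] by metis
  have BA: "B ** (A + mat 1) = (A + mat 1) ** B"
    by (simp add: matrix_distribs assms)
  have comm: "mat_poch_int (A + mat 1) k ** (B ** X) = B ** (mat_poch_int (A + mat 1) k ** X)" for k X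
    by (simp add: matrix_mul_assoc mat_poch_int_commute[OF assms(2) BA])
  have fact: "of_nat (Suc m) * (1 / (fact (Suc m) * fact n)) = 1 / (fact m * fact n :: complex)"
    by (simp del: of_nat_Suc add: fact_Suc)
  show ?thesis
    unfolding h2_coeff_def matrix_inv_mat_poch_Suc[OF assms(4)]
    unfolding P mat_poch_Suc_left cscale_cscale fact
    by (simp add: matrix_mul_assoc[symmetric] comm)
qed

lemma h2_coeff_shift_n:
  assumes "neg_poch_defined A" "\<And>k. invertible (C + mat (of_nat k))" "C ** B' = B' ** C"
  shows "of_nat (Suc n) *\<^sub>M h2_coeff A B B' C m (Suc n) =
    (-1) *\<^sub>M (matrix_inv (mat 1 - A) ** h2_coeff (A - mat 1) B (B' + mat 1) C m n ** B')"
proof -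
  have neg: "neg_poch_defined (A - mat 1)"
    using neg_poch_defined_diff_of_nat[OF assms(1), of 1] by simp
  have inv: "invertible (mat 1 - A)"
    using assms(1) neg_poch_defined_iff[of A] by (metis add.right_neutral mat_0 of_nat_0)
  have "mat_poch_int (A - mat 1) (int m - int (Suc n) + 1)
      = (A - mat 1) ** mat_poch_int A (int m - int (Suc n))"
    using mat_poch_int_add_1_left[OF neg, of "int m - int (Suc n)"] assms(1) by simp
  then have shift: "(-1) *\<^sub>M mat_poch_int (A - mat 1) (int m - int n)
      = (mat 1 - A) ** mat_poch_int A (int m - int (Suc n))"
    by (simp add: matrix_diff_rdistrib cscale_minus_left)
  have P: "mat_poch_int A (int m - int (Suc n))
      = (-1) *\<^sub>M (matrix_inv (mat 1 - A) ** mat_poch_int (A - mat 1) (int m - int n))"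
  proof (rule invertible_cancel_left[OF inv])
    show "(mat 1 - A) ** mat_poch_int A (int m - int (Suc n)) = (mat 1 - A) **
      ((-1) *\<^sub>M (matrix_inv (mat 1 - A) ** mat_poch_int (A - mat 1) (int m - int n)))"
      unfolding shift[symmetric] by (simp add: matrix_mul_assoc matrix_inv_inverse inv)
  qed
  have Q: "mat_poch B' (Suc n) = mat_poch (B' + mat 1) n ** B'"
    unfolding mat_poch_Suc_left by (rule mat_poch_commute) (simp add: matrix_distribs)
  have fact: "of_nat (Suc n) * (1 / (fact m * fact (Suc n))) = 1 / (fact m * fact n :: complex)"
    by (simp del: of_nat_Suc add: fact_Suc)
  show ?thesis
    unfolding h2_coeff_def P Q cscale_cscale fact
    by (simp add: matrix_mul_assoc[symmetric] mat_poch_inv_commute[OF assms(2,3)])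
qed

section \<open>First-order formulae\<close>

lemma has_sum_mult_left:
  fixes f :: "'a \<Rightarrow> complex^'d^'d" and M :: "complex^'d^'d"
  assumes "(f has_sum S) X"
  shows "((\<lambda>p. M ** f p) has_sum (M ** S)) X"
  by (rule has_sum_bounded_linear[OF bounded_bilinear.bounded_linear_right
        [OF bounded_bilinear_matrix_mult] assms])

lemma has_sum_mult_right:
  fixes f :: "'a \<Rightarrow> complex^'d^'d" and M :: "complex^'d^'d"
  assumes "(f has_sum S) X"
  shows "((\<lambda>p. f p ** M) has_sum (S ** M)) X"
  by (rule has_sum_bounded_linear[OF bounded_bilinear.bounded_linear_left
        [OF bounded_bilinear_matrix_mult] assms])

lemma has_sum_cscale:
  assumes "(f has_sum S) X"
  shows "((\<lambda>p. c *\<^sub>M f p) has_sum (c *\<^sub>M S)) X"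
  using has_sum_mult_left[OF assms, of "mat c"] by simp

lemma has_sum_Suc_fst:
  fixes f :: "nat \<times> nat \<Rightarrow> 'a::{comm_monoid_add, topological_space}"
  assumes "\<And>n. f (0, n) = 0"
  shows "(f has_sum S) UNIV \<longleftrightarrow> ((\<lambda>(m, n). f (Suc m, n)) has_sum S) UNIV"
proof -
  let ?g = "\<lambda>(m :: nat, n :: nat). (Suc m, n)"
  have "(f has_sum S) UNIV \<longleftrightarrow> (f has_sum S) (range ?g)"
  proof (rule has_sum_cong_neutral)
    fix p assume "p \<in> UNIV - range ?g"
    moreover have "(Suc m, n) \<in> range ?g" for m n
      by (rule range_eqI[of _ _ "(m, n)"]) simp
    ultimately show "f p = 0"
      using assms by (cases p; cases "fst p") auto
  qed auto
  also have "\<dots> \<longleftrightarrow> ((\<lambda>(m, n). f (Suc m, n)) has_sum S) UNIV"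
    by (subst has_sum_reindex) (auto simp: inj_on_def o_def case_prod_unfold)
  finally show ?thesis .
qed

lemma has_sum_Suc_snd:
  fixes f :: "nat \<times> nat \<Rightarrow> 'a::{comm_monoid_add, topological_space}"
  assumes "\<And>m. f (m, 0) = 0"
  shows "(f has_sum S) UNIV \<longleftrightarrow> ((\<lambda>(m, n). f (m, Suc n)) has_sum S) UNIV"
proof -
  let ?g = "\<lambda>(m :: nat, n :: nat). (m, Suc n)"
  have "(f has_sum S) UNIV \<longleftrightarrow> (f has_sum S) (range ?g)"
  proof (rule has_sum_cong_neutral)
    fix p assume "p \<in> UNIV - range ?g"
    moreover have "(m, Suc n) \<in> range ?g" for m n
      by (rule range_eqI[of _ _ "(m, n)"]) simp
    ultimately show "f p = 0"
      using assms by (cases p; cases "snd p") auto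
  qed auto
  also have "\<dots> \<longleftrightarrow> ((\<lambda>(m, n). f (m, Suc n)) has_sum S) UNIV"
    by (subst has_sum_reindex) (auto simp: inj_on_def o_def case_prod_unfold)
  finally show ?thesis .
qed

lemma invertible_shift_up:
  fixes C :: "complex^'d^'d"
  assumes "\<And>k. invertible (C + mat (of_nat k))"
  shows "invertible (C + mat (of_nat r) + mat (of_nat k))"
  using assms[of "r + k"] by (simp add: mat_add add.assoc)

lemma horn_H2_deriv_x:
  assumes A: "neg_poch_defined A" "neg_poch_defined (A + mat 1)" "A ** B = B ** A"
    and C: "\<And>k. invertible (C + mat (of_nat k))" and x: "x \<in> ball 0 1"
  shows "has_mat_deriv (\<lambda>t. horn_H2 A B B' C t y)
    (A ** B ** horn_H2 (A + mat 1) (B + mat 1) B' (C + mat 1) x y ** matrix_inv C) x"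
proof -
  obtain D where D: "has_mat_deriv (\<lambda>t. horn_H2 A B B' C t y) D x"
    "((\<lambda>(m, n). (of_nat m * x ^ (m - 1) * 1 * y ^ n
        + x ^ m * (of_nat n * y ^ (n - 1) * 0)) *\<^sub>M h2_coeff A B B' C m n) has_sum D) UNIV"
    by (rule horn_H2_has_mat_deriv[OF A(1) C open_ball x, where u = "\<lambda>z. z" and u' = "\<lambda>_. 1"
          and v = "\<lambda>_. y" and v' = "\<lambda>_. 0" and B = B and B' = B'])
       (auto intro!: derivative_eq_intros)
  let ?c' = "h2_coeff (A + mat 1) (B + mat 1) B' (C + mat 1)"
  have "((\<lambda>(m, n). (x ^ m * y ^ n) *\<^sub>M of_nat (Suc m) *\<^sub>M h2_coeff A B B' C (Suc m) n) has_sum D) UNIV"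
    using D(2) by (subst (asm) has_sum_Suc_fst) (simp_all add: mult_ac del: of_nat_Suc)
  moreover have "((\<lambda>(m, n). (x ^ m * y ^ n) *\<^sub>M of_nat (Suc m) *\<^sub>M h2_coeff A B B' C (Suc m) n)
      has_sum (A ** B ** horn_H2 (A + mat 1) (B + mat 1) B' (C + mat 1) x y ** matrix_inv C)) UNIV"
  proof -
    have "invertible (C + mat 1 + mat (of_nat k))" for k
      using invertible_shift_up[OF C, of 1 k] by simp
    from has_sum_mult_right[OF has_sum_mult_left[OF horn_H2_has_sum[OF A(2) this]], of x "A ** B"]
    show ?thesis
      unfolding h2_coeff_shift_m[OF A C] using x by (simp add: case_prod_unfold)
  qed
  ultimately have "D = A ** B ** horn_H2 (A + mat 1) (B + mat 1) B' (C + mat 1) x y ** matrix_inv C"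
    by (rule has_sum_unique)
  with D(1) show ?thesis
    by simp
qed

lemma horn_H2_deriv_y:
  assumes A: "neg_poch_defined A" and C: "\<And>k. invertible (C + mat (of_nat k))"
    and CB': "C ** B' = B' ** C" and x: "x \<in> ball 0 1"
  shows "has_mat_deriv (\<lambda>t. horn_H2 A B B' C x t)
    ((-1) *\<^sub>M (matrix_inv (mat 1 - A) ** horn_H2 (A - mat 1) B (B' + mat 1) C x y ** B')) y"
proof -
  have x': "norm x < 1"
    using x by simp
  obtain D where D: "has_mat_deriv (\<lambda>t. horn_H2 A B B' C x t) D y"
    "((\<lambda>(m, n). (of_nat m * x ^ (m - 1) * 0 * y ^ n
        + x ^ m * (of_nat n * y ^ (n - 1) * 1)) *\<^sub>M h2_coeff A B B' C m n) has_sum D) UNIV"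
    by (rule horn_H2_has_mat_deriv[OF A C open_UNIV UNIV_I, where t = y and u = "\<lambda>_. x"
          and u' = "\<lambda>_. 0" and v = "\<lambda>z. z" and v' = "\<lambda>_. 1" and B = B and B' = B'])
       (use x' in \<open>auto intro!: derivative_eq_intros\<close>)
  have "((\<lambda>(m, n). (x ^ m * y ^ n) *\<^sub>M of_nat (Suc n) *\<^sub>M h2_coeff A B B' C m (Suc n)) has_sum D) UNIV"
    using D(2) by (subst (asm) has_sum_Suc_snd) (simp_all add: mult_ac del: of_nat_Suc)
  moreover have "((\<lambda>(m, n). (x ^ m * y ^ n) *\<^sub>M of_nat (Suc n) *\<^sub>M h2_coeff A B B' C m (Suc n))
      has_sum ((-1) *\<^sub>M (matrix_inv (mat 1 - A) ** horn_H2 (A - mat 1) B (B' + mat 1) C x y ** B'))) UNIV"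
  proof -
    have "neg_poch_defined (A - mat 1)"
      using neg_poch_defined_diff_of_nat[OF A, of 1] by simp
    from has_sum_cscale[OF has_sum_mult_right[OF has_sum_mult_left[OF horn_H2_has_sum[OF this C x']]],
        of "-1" "matrix_inv (mat 1 - A)"]
    show ?thesis
      unfolding h2_coeff_shift_n[OF A C CB'] by (simp add: case_prod_unfold)
  qed
  ultimately have "D = (-1) *\<^sub>M (matrix_inv (mat 1 - A) ** horn_H2 (A - mat 1) B (B' + mat 1) C x y ** B')"
    by (rule has_sum_unique)
  with D(1) show ?thesis
    by simp
qed

lemma of_nat_mult_power_pred: "(of_nat m * x ^ (m - 1)) * x = (of_nat m * x ^ m :: complex)"
  by (cases m) simp_all

lemma horn_H2_euler_x:
  assumes A: "neg_poch_defined A" and C: "\<And>k. invertible (C + mat (of_nat k))" and x: "x \<in> ball 0 1"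
  obtains D where "has_mat_deriv (\<lambda>t. horn_H2 A B B' C t y) D x"
    and "((\<lambda>(m, n). (of_nat m * (x ^ m * y ^ n)) *\<^sub>M h2_coeff A B B' C m n) has_sum (x *\<^sub>M D)) UNIV"
proof -
  obtain D where D: "has_mat_deriv (\<lambda>t. horn_H2 A B B' C t y) D x"
    "((\<lambda>(m, n). (of_nat m * x ^ (m - 1) * 1 * y ^ n
        + x ^ m * (of_nat n * y ^ (n - 1) * 0)) *\<^sub>M h2_coeff A B B' C m n) has_sum D) UNIV"
    by (rule horn_H2_has_mat_deriv[OF A C open_ball x, where u = "\<lambda>z. z" and u' = "\<lambda>_. 1"
          and v = "\<lambda>_. y" and v' = "\<lambda>_. 0" and B = B and B' = B'])
       (auto intro!: derivative_eq_intros)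
  have eq: "x * (of_nat m * x ^ (m - 1) * 1 * y ^ n + x ^ m * (of_nat n * y ^ (n - 1) * 0))
      = of_nat m * (x ^ m * y ^ n)" for m n
    by (cases m) (simp_all add: algebra_simps)
  from has_sum_cscale[OF D(2), of x]
  have "((\<lambda>(m, n). (of_nat m * (x ^ m * y ^ n)) *\<^sub>M h2_coeff A B B' C m n) has_sum (x *\<^sub>M D)) UNIV"
    by (simp only: case_prod_unfold cscale_cscale eq)
  with D(1) show thesis
    by (rule that)
qed

lemma horn_H2_euler_y:
  assumes A: "neg_poch_defined A" and C: "\<And>k. invertible (C + mat (of_nat k))" and x: "x \<in> ball 0 1"
  obtains D where "has_mat_deriv (\<lambda>t. horn_H2 A B B' C x t) D y"
    and "((\<lambda>(m, n). (of_nat n * (x ^ m * y ^ n)) *\<^sub>M h2_coeff A B B' C m n) has_sum (y *\<^sub>M D)) UNIV"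
proof -
  obtain D where D: "has_mat_deriv (\<lambda>t. horn_H2 A B B' C x t) D y"
    "((\<lambda>(m, n). (of_nat m * x ^ (m - 1) * 0 * y ^ n
        + x ^ m * (of_nat n * y ^ (n - 1) * 1)) *\<^sub>M h2_coeff A B B' C m n) has_sum D) UNIV"
    by (rule horn_H2_has_mat_deriv[OF A C open_UNIV UNIV_I, where t = y and u = "\<lambda>_. x"
          and u' = "\<lambda>_. 0" and v = "\<lambda>z. z" and v' = "\<lambda>_. 1" and B = B and B' = B'])
       (use x in \<open>auto intro!: derivative_eq_intros\<close>)
  have eq: "y * (of_nat m * x ^ (m - 1) * 0 * y ^ n + x ^ m * (of_nat n * y ^ (n - 1) * 1))
      = of_nat n * (x ^ m * y ^ n)" for m n
    by (cases n) (simp_all add: algebra_simps)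
  from has_sum_cscale[OF D(2), of y]
  have "((\<lambda>(m, n). (of_nat n * (x ^ m * y ^ n)) *\<^sub>M h2_coeff A B B' C m n) has_sum (y *\<^sub>M D)) UNIV"
    by (simp only: case_prod_unfold cscale_cscale eq)
  with D(1) show thesis
    by (rule that)
qed

text \<open>In \<open>t\<^sup>m (y / t)\<^sup>n\<close> the variable \<open>t\<close> has exponent \<open>m - n\<close>, the index of the Pochhammer symbol
of \<open>A\<close>.\<close>

lemma horn_H2_euler_quotient:
  assumes A: "neg_poch_defined A" and C: "\<And>k. invertible (C + mat (of_nat k))"
    and t: "t \<in> ball 0 1" "t \<noteq> 0"
  obtains D where "has_mat_deriv (\<lambda>t. horn_H2 A B B' C t (y / t)) D t"
    and "((\<lambda>(m, n). ((of_nat m - of_nat n) * (t ^ m * (y / t) ^ n)) *\<^sub>M h2_coeff A B B' C m n)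
      has_sum (t *\<^sub>M D)) UNIV"
proof -
  have S: "open (ball 0 1 - {0 :: complex})" "t \<in> ball 0 1 - {0}"
    using t by auto
  obtain D where D: "has_mat_deriv (\<lambda>t. horn_H2 A B B' C t (y / t)) D t"
    "((\<lambda>(m, n). (of_nat m * t ^ (m - 1) * 1 * (y / t) ^ n
        + t ^ m * (of_nat n * (y / t) ^ (n - 1) * (- y / t\<^sup>2))) *\<^sub>M h2_coeff A B B' C m n) has_sum D) UNIV"
    by (rule horn_H2_has_mat_deriv[OF A C S, where u = "\<lambda>z. z" and u' = "\<lambda>_. 1"
          and v = "\<lambda>z. y / z" and v' = "\<lambda>z. - y / z\<^sup>2" and B = B and B' = B'])
       (auto intro!: derivative_eq_intros simp: power2_eq_square)
  have euler: "t * (of_nat m * t ^ (m - 1) * 1 * w ^ n + t ^ m * (of_nat n * w ^ (n - 1) * z))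
      = (of_nat m - of_nat n) * (t ^ m * w ^ n)" if "t * z = - w" for m n w z
  proof -
    have "t * (of_nat m * t ^ (m - 1) * 1 * w ^ n + t ^ m * (of_nat n * w ^ (n - 1) * z))
        = (of_nat m * t ^ (m - 1) * t) * w ^ n + t ^ m * (of_nat n * w ^ (n - 1) * (t * z))"
      by (simp add: algebra_simps)
    also have "\<dots> = (of_nat m * t ^ (m - 1) * t) * w ^ n - t ^ m * (of_nat n * w ^ (n - 1) * w)"
      by (simp add: that)
    finally show ?thesis
      unfolding of_nat_mult_power_pred by (simp add: algebra_simps)
  qed
  have "t * (- y / t\<^sup>2) = - (y / t)"
    using t(2) by (simp add: power2_eq_square)
  note euler = euler[OF this]
  from has_sum_cscale[OF D(2), of t]
  have "((\<lambda>(m, n). ((of_nat m - of_nat n) * (t ^ m * (y / t) ^ n)) *\<^sub>M h2_coeff A B B' C m n)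
      has_sum (t *\<^sub>M D)) UNIV"
    by (simp only: case_prod_unfold cscale_cscale euler)
  with D(1) show thesis
    by (rule that)
qed

text \<open>Passes from a contiguity relation between coefficients to one between the sums; \<open>E\<close> is the value of the
Euler operator.\<close>

lemma has_sum_euler_left:
  assumes "((\<lambda>(m, n). (e m n * p m n) *\<^sub>M c m n) has_sum E) UNIV"
    and "((\<lambda>(m, n). p m n *\<^sub>M c m n) has_sum H) UNIV"
    and "((\<lambda>(m, n). p m n *\<^sub>M c' m n) has_sum H') UNIV"
    and "\<And>m n. M ** c m n + e m n *\<^sub>M c m n = M ** c' m n"
  shows "M ** H + E = M ** H'"
proof -
  have "((\<lambda>(m, n). p m n *\<^sub>M (M ** c m n + e m n *\<^sub>M c m n)) has_sum (M ** H + E)) UNIV"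
    using has_sum_add[OF has_sum_mult_left[OF assms(2), of M] assms(1)]
    by (simp add: case_prod_unfold cscale_add_right mult.commute)
  moreover have "((\<lambda>(m, n). p m n *\<^sub>M (M ** c m n + e m n *\<^sub>M c m n)) has_sum (M ** H')) UNIV"
    using has_sum_mult_left[OF assms(3), of M] by (simp add: case_prod_unfold assms(4))
  ultimately show ?thesis
    by (rule has_sum_unique)
qed

lemma has_sum_euler_right:
  assumes "((\<lambda>(m, n). (e m n * p m n) *\<^sub>M c m n) has_sum E) UNIV"
    and "((\<lambda>(m, n). p m n *\<^sub>M c m n) has_sum H) UNIV"
    and "((\<lambda>(m, n). p m n *\<^sub>M c' m n) has_sum H') UNIV"
    and "\<And>m n. c m n ** M + e m n *\<^sub>M c m n = c' m n ** M"
  shows "H ** M + E = H' ** M"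
proof -
  have "((\<lambda>(m, n). p m n *\<^sub>M (c m n ** M + e m n *\<^sub>M c m n)) has_sum (H ** M + E)) UNIV"
    using has_sum_add[OF has_sum_mult_right[OF assms(2), of M] assms(1)]
    by (simp add: case_prod_unfold cscale_add_right mult.commute)
  moreover have "((\<lambda>(m, n). p m n *\<^sub>M (c m n ** M + e m n *\<^sub>M c m n)) has_sum (H' ** M)) UNIV"
    using has_sum_mult_right[OF assms(3), of M] by (simp add: case_prod_unfold assms(4))
  ultimately show ?thesis
    by (rule has_sum_unique)
qed

text \<open>Conjugating the Euler operator by \<open>t\<^sup>M\<close> turns it into \<open>M + t d/dt\<close>, which is the operator computed
by the contiguity relations.\<close>

lemma has_mat_deriv_mat_powr_mult:
  assumes "t \<notin> \<real>\<^sub>\<le>\<^sub>0" "has_mat_deriv F D t" "M ** F t + t *\<^sub>M D = M ** G"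
  shows "has_mat_deriv (\<lambda>t. mat_powr t M ** F t) ((1 / t) *\<^sub>M (M ** (mat_powr t M ** G))) t"
proof -
  have t: "t \<noteq> 0"
    using assms(1) by auto
  have comm: "mat_powr t M ** M = M ** mat_powr t M"
    by (rule mat_powr_commute[symmetric]) simp
  have "((1 / t) *\<^sub>M (M ** mat_powr t M)) ** F t + mat_powr t M ** D
      = (1 / t) *\<^sub>M (mat_powr t M ** (M ** F t + t *\<^sub>M D))"
    using t by (simp add: matrix_add_ldistrib cscale_add_right matrix_mul_assoc comm)
  also have "\<dots> = (1 / t) *\<^sub>M (M ** (mat_powr t M ** G))"
    by (simp add: assms(3) matrix_mul_assoc comm)
  finally show ?thesis
    using has_mat_deriv_mult[OF has_mat_deriv_mat_powr[OF assms(1), of M] assms(2)] by simp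
qed

lemma has_mat_deriv_mult_mat_powr:
  assumes "t \<notin> \<real>\<^sub>\<le>\<^sub>0" "has_mat_deriv F D t" "F t ** M + t *\<^sub>M D = G ** M"
  shows "has_mat_deriv (\<lambda>t. F t ** mat_powr t M) ((1 / t) *\<^sub>M (G ** mat_powr t M ** M)) t"
proof -
  have t: "t \<noteq> 0"
    using assms(1) by auto
  have comm: "M ** mat_powr t M = mat_powr t M ** M"
    by (rule mat_powr_commute) simp
  have "D ** mat_powr t M + F t ** ((1 / t) *\<^sub>M (M ** mat_powr t M))
      = (1 / t) *\<^sub>M ((F t ** M + t *\<^sub>M D) ** mat_powr t M)"
    using t by (simp add: matrix_add_rdistrib cscale_add_right matrix_mul_assoc add.commute)
  also have "\<dots> = (1 / t) *\<^sub>M (G ** mat_powr t M ** M)"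
    by (simp add: assms(3) matrix_mul_assoc[symmetric] comm)
  finally show ?thesis
    using has_mat_deriv_mult[OF assms(2) has_mat_deriv_mat_powr[OF assms(1), of M]] by simp
qed

lemma horn_H2_deriv_powr_A:
  assumes A: "neg_poch_defined A" "neg_poch_defined (A + mat 1)"
    and C: "\<And>k. invertible (C + mat (of_nat k))" and t: "t \<in> ball 0 1 - \<real>\<^sub>\<le>\<^sub>0"
  shows "has_mat_deriv (\<lambda>t. mat_powr t A ** horn_H2 A B B' C t (y / t))
    ((1 / t) *\<^sub>M (A ** (mat_powr t A ** horn_H2 (A + mat 1) B B' C t (y / t)))) t"
proof -
  have t': "t \<in> ball 0 1" "norm t < 1" "t \<noteq> 0" "t \<notin> \<real>\<^sub>\<le>\<^sub>0"
    using t by auto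
  obtain D where D: "has_mat_deriv (\<lambda>t. horn_H2 A B B' C t (y / t)) D t"
    "((\<lambda>(m, n). ((of_nat m - of_nat n) * (t ^ m * (y / t) ^ n)) *\<^sub>M h2_coeff A B B' C m n)
      has_sum (t *\<^sub>M D)) UNIV"
    using horn_H2_euler_quotient[OF A(1) C t'(1,3)] by blast
  show ?thesis
    by (rule has_mat_deriv_mat_powr_mult[OF t'(4) D(1)], rule has_sum_euler_left[OF D(2)
          horn_H2_has_sum[OF A(1) C t'(2)] horn_H2_has_sum[OF A(2) C t'(2)]], rule h2_coeff_euler_A[OF A])
qed

lemma horn_H2_deriv_powr_B:
  assumes A: "neg_poch_defined A" "A ** B = B ** A"
    and C: "\<And>k. invertible (C + mat (of_nat k))" and t: "t \<in> ball 0 1 - \<real>\<^sub>\<le>\<^sub>0"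
  shows "has_mat_deriv (\<lambda>t. mat_powr t B ** horn_H2 A B B' C t y)
    ((1 / t) *\<^sub>M (B ** (mat_powr t B ** horn_H2 A (B + mat 1) B' C t y))) t"
proof -
  have t': "t \<in> ball 0 1" "norm t < 1" "t \<notin> \<real>\<^sub>\<le>\<^sub>0"
    using t by auto
  obtain D where D: "has_mat_deriv (\<lambda>t. horn_H2 A B B' C t y) D t"
    "((\<lambda>(m, n). (of_nat m * (t ^ m * y ^ n)) *\<^sub>M h2_coeff A B B' C m n) has_sum (t *\<^sub>M D)) UNIV"
    using horn_H2_euler_x[OF A(1) C t'(1)] by blast
  show ?thesis
    by (rule has_mat_deriv_mat_powr_mult[OF t'(3) D(1)], rule has_sum_euler_left[OF D(2)
          horn_H2_has_sum[OF A(1) C t'(2)] horn_H2_has_sum[OF A(1) C t'(2)]], rule h2_coeff_euler_B[OF A])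
qed

lemma horn_H2_deriv_powr_B':
  assumes A: "neg_poch_defined A" and C: "\<And>k. invertible (C + mat (of_nat k))"
    and CB': "C ** B' = B' ** C" and x: "x \<in> ball 0 1" and t: "t \<notin> \<real>\<^sub>\<le>\<^sub>0"
  shows "has_mat_deriv (\<lambda>t. horn_H2 A B B' C x t ** mat_powr t B')
    ((1 / t) *\<^sub>M (horn_H2 A B (B' + mat 1) C x t ** mat_powr t B' ** B')) t"
proof -
  have x': "norm x < 1"
    using x by simp
  obtain D where D: "has_mat_deriv (\<lambda>t. horn_H2 A B B' C x t) D t"
    "((\<lambda>(m, n). (of_nat n * (x ^ m * t ^ n)) *\<^sub>M h2_coeff A B B' C m n) has_sum (t *\<^sub>M D)) UNIV"
    using horn_H2_euler_y[OF A C x] by blast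
  show ?thesis
    by (rule has_mat_deriv_mult_mat_powr[OF t D(1)], rule has_sum_euler_right[OF D(2)
          horn_H2_has_sum[OF A C x'] horn_H2_has_sum[OF A C x']], rule h2_coeff_euler_B'[OF C CB'])
qed

lemma horn_H2_deriv_powr_C:
  assumes A: "neg_poch_defined A" and C: "\<And>k. invertible (C - mat 1 + mat (of_nat k))"
    and t: "t \<in> ball 0 1 - \<real>\<^sub>\<le>\<^sub>0"
  shows "has_mat_deriv (\<lambda>t. horn_H2 A B B' C t y ** mat_powr t (C - mat 1))
    (horn_H2 A B B' (C - mat 1) t y ** mat_powr t (C - mat 1 - mat 1) ** (C - mat 1)) t"
proof -
  have t': "t \<in> ball 0 1" "norm t < 1" "t \<noteq> 0" "t \<notin> \<real>\<^sub>\<le>\<^sub>0"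
    using t by auto
  have C': "invertible (C + mat (of_nat k))" for k
    using C[of "Suc k"] by (simp add: mat_add)
  have C1: "invertible (C - mat 1)"
    using C[of 0] by simp
  obtain D where D: "has_mat_deriv (\<lambda>t. horn_H2 A B B' C t y) D t"
    "((\<lambda>(m, n). (of_nat m * (t ^ m * y ^ n)) *\<^sub>M h2_coeff A B B' C m n) has_sum (t *\<^sub>M D)) UNIV"
    using horn_H2_euler_x[OF A C' t'(1)] by blast
  have "has_mat_deriv (\<lambda>t. horn_H2 A B B' C t y ** mat_powr t (C - mat 1))
    ((1 / t) *\<^sub>M (horn_H2 A B B' (C - mat 1) t y ** mat_powr t (C - mat 1) ** (C - mat 1))) t"
    by (rule has_mat_deriv_mult_mat_powr[OF t'(4) D(1)], rule has_sum_euler_right[OF D(2)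
          horn_H2_has_sum[OF A C' t'(2)] horn_H2_has_sum[OF A C t'(2)]], rule h2_coeff_euler_C[OF C' C1])
  then show ?thesis
    using t'(3) unfolding mat_powr_diff_1[OF t'(3), of "C - mat 1"] by simp
qed

section \<open>Formulae of arbitrary order\<close>

lemma add_mat_Suc: "X + mat (of_nat k) + mat 1 = X + (mat (of_nat (Suc k)) :: complex^'d^'d)"
  by (simp add: vec_eq_iff mat_def)

lemma diff_mat_Suc: "X - mat (of_nat k) - mat 1 = X - (mat (of_nat (Suc k)) :: complex^'d^'d)"
  by (simp add: vec_eq_iff mat_def)

lemma open_slit_disc: "open (ball 0 1 - \<real>\<^sub>\<le>\<^sub>0 :: complex set)"
  by (intro open_Diff open_ball closed_nonpos_Reals_complex)

lemma open_slit_plane: "open (- \<real>\<^sub>\<le>\<^sub>0 :: complex set)"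
  by (simp add: open_Compl closed_nonpos_Reals_complex)

text \<open>Besides the derivative formula of first order, the induction step uses that the new left factors sort into
\<open>(A)\<^bsub>k+1\<^esub> (B)\<^bsub>k+1\<^esub>\<close>, since \<open>A\<close> commutes with \<open>(B)\<^sub>k\<close>.\<close>

lemma horn_H2_higher_deriv_x:
  assumes A: "neg_poch_defined A" "neg_poch_defined (A + mat (of_nat r))" "A ** B = B ** A"
    and C: "\<And>k. invertible (C + mat (of_nat k))" and x: "x \<in> ball 0 1"
  shows "(mat_deriv ^^ r) (\<lambda>t. horn_H2 A B B' C t y) x = mat_poch A r ** mat_poch B r
    ** horn_H2 (A + mat (of_nat r)) (B + mat (of_nat r)) B' (C + mat (of_nat r)) x y
    ** matrix_inv (mat_poch C r)"
proof -
  define H where "H k t = horn_H2 (A + mat (of_nat k)) (B + mat (of_nat k)) B' (C + mat (of_nat k)) t y" for k t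
  define G where "G k t = mat_poch A k ** mat_poch B k ** H k t ** matrix_inv (mat_poch C k)" for k t
  have "(mat_deriv ^^ r) (G 0) x = G r x"
  proof (rule mat_deriv_iterate[OF open_ball x])
    fix k and t :: complex
    assume k: "k < r" and t: "t \<in> ball 0 1"
    let ?A = "A + mat (of_nat k)" and ?B = "B + mat (of_nat k)" and ?C = "C + mat (of_nat k)"
    have negA: "neg_poch_defined ?A" "neg_poch_defined (?A + mat 1)"
      using k neg_poch_defined_add_le[OF A(2), of k] neg_poch_defined_add_le[OF A(2), of "Suc k"]
      unfolding add_mat_Suc by simp_all
    have comm: "?A ** ?B = ?B ** ?A"
      by (simp add: matrix_distribs A(3) cscale_add_right add_ac mult.commute)
    have "has_mat_deriv (H k) (?A ** ?B ** H (Suc k) t ** matrix_inv ?C) t"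
      unfolding H_def
      using horn_H2_deriv_x[OF negA comm invertible_shift_up[OF C, of k] t, of B' y] unfolding add_mat_Suc .
    then have "has_mat_deriv (G k) (mat_poch A k ** mat_poch B k
        ** (?A ** ?B ** H (Suc k) t ** matrix_inv ?C) ** matrix_inv (mat_poch C k)) t"
      unfolding G_def by (intro has_mat_deriv_mult_left has_mat_deriv_mult_right)
    also have "mat_poch A k ** mat_poch B k ** (?A ** ?B ** H (Suc k) t ** matrix_inv ?C)
        ** matrix_inv (mat_poch C k) = G (Suc k) t"
    proof -
      have "?A ** B = B ** ?A"
        by (simp add: matrix_distribs A(3))
      then have "mat_poch B k ** ?A = ?A ** mat_poch B k"
        by (rule mat_poch_commute[symmetric])
      then have *: "mat_poch B k ** (?A ** X) = ?A ** (mat_poch B k ** X)" for X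
        by (simp add: matrix_mul_assoc)
      have "matrix_inv (mat_poch C (Suc k)) = matrix_inv ?C ** matrix_inv (mat_poch C k)"
        by (simp add: matrix_inv_mult invertible_mat_poch C)
      then show ?thesis
        unfolding G_def by (simp only: mat_poch.simps matrix_mul_assoc[symmetric] *)
    qed
    finally show "has_mat_deriv (G k) (G (Suc k) t) t" .
  qed
  then show ?thesis
    by (simp add: G_def[abs_def] H_def)
qed

lemma horn_H2_higher_deriv_y:
  assumes A: "neg_poch_defined A" and C: "\<And>k. invertible (C + mat (of_nat k))"
    and CB': "C ** B' = B' ** C" and x: "x \<in> ball 0 1"
  shows "(mat_deriv ^^ r) (\<lambda>t. horn_H2 A B B' C x t) y =
    (-1) ^ r *\<^sub>M (matrix_inv (mat_poch (mat 1 - A) r)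
      ** horn_H2 (A - mat (of_nat r)) B (B' + mat (of_nat r)) C x y ** mat_poch B' r)"
proof -
  define H where "H k t = horn_H2 (A - mat (of_nat k)) B (B' + mat (of_nat k)) C x t" for k t
  define P where "P k = matrix_inv (mat_poch (mat 1 - A) k)" for k
  define G where "G k t = (-1) ^ k *\<^sub>M (P k ** H k t ** mat_poch B' k)" for k t
  have inv: "invertible (mat 1 - A + mat (of_nat k))" for k
    using A by (simp add: neg_poch_defined_iff)
  have "(mat_deriv ^^ r) (G 0) y = G r y"
  proof (rule mat_deriv_iterate[OF open_UNIV UNIV_I])
    fix k and t :: complex
    let ?A = "A - mat (of_nat k)" and ?B' = "B' + mat (of_nat k)"
    have comm: "C ** ?B' = ?B' ** C"
      by (simp add: matrix_distribs CB')
    have "has_mat_deriv (H k) ((-1) *\<^sub>M (matrix_inv (mat 1 - ?A) ** H (Suc k) t ** ?B')) t"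
      unfolding H_def
      using horn_H2_deriv_y[OF neg_poch_defined_diff_of_nat[OF A] C comm x, of k B t]
      unfolding add_mat_Suc diff_mat_Suc .
    then have "has_mat_deriv (\<lambda>t. P k ** H k t ** mat_poch B' k)
        (P k ** ((-1) *\<^sub>M (matrix_inv (mat 1 - ?A) ** H (Suc k) t ** ?B')) ** mat_poch B' k) t"
      by (intro has_mat_deriv_mult_left has_mat_deriv_mult_right)
    from has_mat_deriv_mult_left[OF this, of "mat ((-1) ^ k)"]
    have "has_mat_deriv (G k)
        ((-1) ^ Suc k *\<^sub>M ((P k ** matrix_inv (mat 1 - ?A)) ** H (Suc k) t ** (?B' ** mat_poch B' k))) t"
      unfolding G_def[abs_def] by (simp add: matrix_mul_assoc mult.commute)
    also have "P k ** matrix_inv (mat 1 - ?A) = P (Suc k)"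
    proof -
      have "mat 1 - ?A = mat 1 - A + mat (of_nat k)"
        by simp
      then show ?thesis
        unfolding P_def mat_poch_Suc_left' using inv
        by (simp only: matrix_inv_mult invertible_mat_poch)
    qed
    also have "(-1) ^ Suc k *\<^sub>M (P (Suc k) ** H (Suc k) t ** (?B' ** mat_poch B' k)) = G (Suc k) t"
      unfolding G_def mat_poch_Suc_left' ..
    finally show "has_mat_deriv (G k) (G (Suc k) t) t" .
  qed
  then show ?thesis
    by (simp add: G_def[abs_def] H_def P_def)
qed

text \<open>One application of \<open>t\<^sup>2 d/dt\<close> turns \<open>t\<^bsup>M+kI\<^esup> H\<^sub>k\<close> into
\<open>(M + k I) t\<^bsup>M+(k+1)I\<^esup> H\<^bsub>k+1\<^esub>\<close>: of the two powers of \<open>t\<close> one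
cancels against the derivative of \<open>t\<^sup>M\<close> and the other raises the exponent. The left factors accumulate
to a Pochhammer symbol.\<close>

lemma sq_deriv_iterate_left:
  assumes "open S" "x \<in> S" "0 \<notin> S"
    and "\<And>k t. k < r \<Longrightarrow> t \<in> S \<Longrightarrow> has_mat_deriv (F k)
      ((1 / t) *\<^sub>M ((M + mat (of_nat k)) ** (mat_powr t (M + mat (of_nat k)) ** H (Suc k) t))) t"
    and F: "\<And>k t. F k t = mat_powr t (M + mat (of_nat k)) ** H k t"
  shows "(sq_deriv ^^ r) (F 0) x = mat_powr x (M + mat (of_nat r)) ** mat_poch M r ** H r x"
proof -
  define G where "G k t = mat_poch M k ** F k t" for k t
  have "(sq_deriv ^^ r) (G 0) x = G r x"
  proof (rule sq_deriv_iterate[OF assms(1,2)])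
    fix k and t :: complex assume kt: "k < r" "t \<in> S"
    let ?D = "\<lambda>k t. (1 / t) *\<^sub>M ((M + mat (of_nat k)) ** (mat_powr t (M + mat (of_nat k)) ** H (Suc k) t))"
    show "has_mat_deriv (G k) (mat_poch M k ** ?D k t) t"
      unfolding G_def by (rule has_mat_deriv_mult_left) (rule assms(4)[OF kt])
    have "t \<noteq> 0"
      using kt(2) assms(3) by auto
    then have "t\<^sup>2 *\<^sub>M (mat_poch M k ** ?D k t) = mat_poch M (Suc k)
        ** ((t *\<^sub>M mat_powr t (M + mat (of_nat k))) ** H (Suc k) t)"
      by (simp add: matrix_mul_assoc power2_eq_square)
    then show "t\<^sup>2 *\<^sub>M (mat_poch M k ** ?D k t) = G (Suc k) t"
      unfolding G_def F add_mat_Suc[symmetric] mat_powr_add_1[OF \<open>t \<noteq> 0\<close>] .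
  qed
  moreover have "mat_poch M r ** mat_powr x (M + mat (of_nat r)) = mat_powr x (M + mat (of_nat r)) ** mat_poch M r"
  proof (rule mat_powr_commute, rule mat_poch_commute[symmetric])
    show "(M + mat (of_nat r)) ** M = M ** (M + mat (of_nat r))"
      by (simp add: matrix_distribs)
  qed
  moreover have "G 0 = F 0" "G r x = mat_poch M r ** mat_powr x (M + mat (of_nat r)) ** H r x"
    by (simp_all add: G_def fun_eq_iff F matrix_mul_assoc)
  ultimately show ?thesis
    by simp
qed

lemma sq_deriv_iterate_right:
  assumes "open S" "x \<in> S" "0 \<notin> S"
    and "\<And>k t. k < r \<Longrightarrow> t \<in> S \<Longrightarrow> has_mat_deriv (F k)
      ((1 / t) *\<^sub>M (H (Suc k) t ** mat_powr t (M + mat (of_nat k)) ** (M + mat (of_nat k)))) t"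
    and F: "\<And>k t. F k t = H k t ** mat_powr t (M + mat (of_nat k))"
  shows "(sq_deriv ^^ r) (F 0) x = H r x ** mat_powr x (M + mat (of_nat r)) ** mat_poch M r"
proof -
  define G where "G k t = F k t ** mat_poch M k" for k t
  have "(sq_deriv ^^ r) (G 0) x = G r x"
  proof (rule sq_deriv_iterate[OF assms(1,2)])
    fix k and t :: complex assume kt: "k < r" "t \<in> S"
    let ?D = "\<lambda>k t. (1 / t) *\<^sub>M (H (Suc k) t ** mat_powr t (M + mat (of_nat k)) ** (M + mat (of_nat k)))"
    show "has_mat_deriv (G k) (?D k t ** mat_poch M k) t"
      unfolding G_def by (rule has_mat_deriv_mult_right) (rule assms(4)[OF kt])
    have "t \<noteq> 0"
      using kt(2) assms(3) by auto
    then have "t\<^sup>2 *\<^sub>M (?D k t ** mat_poch M k) =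
        H (Suc k) t ** (t *\<^sub>M mat_powr t (M + mat (of_nat k))) ** mat_poch M (Suc k)"
      unfolding mat_poch_Suc_left' by (simp add: matrix_mul_assoc power2_eq_square)
    then show "t\<^sup>2 *\<^sub>M (?D k t ** mat_poch M k) = G (Suc k) t"
      unfolding G_def F add_mat_Suc[symmetric] mat_powr_add_1[OF \<open>t \<noteq> 0\<close>] .
  qed
  moreover have "G 0 = F 0" "G r x = H r x ** mat_powr x (M + mat (of_nat r)) ** mat_poch M r"
    by (simp_all add: G_def fun_eq_iff F)
  ultimately show ?thesis
    by simp
qed

lemma horn_H2_higher_deriv_powr_A:
  assumes A: "neg_poch_defined A" "neg_poch_defined (A + mat (of_nat r))"
    and C: "\<And>k. invertible (C + mat (of_nat k))" and x: "x \<in> ball 0 1 - \<real>\<^sub>\<le>\<^sub>0"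
  shows "(sq_deriv ^^ r) (\<lambda>t. mat_powr t A ** horn_H2 A B B' C t (y / t)) x =
    mat_powr x (A + mat (of_nat r)) ** mat_poch A r ** horn_H2 (A + mat (of_nat r)) B B' C x (y / x)"
proof -
  let ?H = "\<lambda>k t. horn_H2 (A + mat (of_nat k)) B B' C t (y / t)"
  have "(sq_deriv ^^ r) ((\<lambda>k t. mat_powr t (A + mat (of_nat k)) ** ?H k t) 0) x =
    mat_powr x (A + mat (of_nat r)) ** mat_poch A r ** ?H r x"
  proof (rule sq_deriv_iterate_left[OF open_slit_disc x])
    fix k and t :: complex assume k: "k < r" and t: "t \<in> ball 0 1 - \<real>\<^sub>\<le>\<^sub>0"
    have negA: "neg_poch_defined (A + mat (of_nat k))" "neg_poch_defined (A + mat (of_nat k) + mat 1)"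
      using k neg_poch_defined_add_le[OF A(2), of k] neg_poch_defined_add_le[OF A(2), of "Suc k"]
      unfolding add_mat_Suc by simp_all
    show "has_mat_deriv (\<lambda>t. mat_powr t (A + mat (of_nat k)) ** ?H k t) ((1 / t) *\<^sub>M
        ((A + mat (of_nat k)) ** (mat_powr t (A + mat (of_nat k)) ** ?H (Suc k) t))) t"
      using horn_H2_deriv_powr_A[OF negA C t, of B B' y] unfolding add_mat_Suc .
  qed auto
  then show ?thesis
    by simp
qed

lemma horn_H2_higher_deriv_powr_B:
  assumes A: "neg_poch_defined A" "A ** B = B ** A"
    and C: "\<And>k. invertible (C + mat (of_nat k))" and x: "x \<in> ball 0 1 - \<real>\<^sub>\<le>\<^sub>0"
  shows "(sq_deriv ^^ r) (\<lambda>t. mat_powr t B ** horn_H2 A B B' C t y) x =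
    mat_powr x (B + mat (of_nat r)) ** mat_poch B r ** horn_H2 A (B + mat (of_nat r)) B' C x y"
proof -
  let ?H = "\<lambda>k t. horn_H2 A (B + mat (of_nat k)) B' C t y"
  have "(sq_deriv ^^ r) ((\<lambda>k t. mat_powr t (B + mat (of_nat k)) ** ?H k t) 0) x =
    mat_powr x (B + mat (of_nat r)) ** mat_poch B r ** ?H r x"
  proof (rule sq_deriv_iterate_left[OF open_slit_disc x])
    fix k and t :: complex assume t: "t \<in> ball 0 1 - \<real>\<^sub>\<le>\<^sub>0"
    have comm: "A ** (B + mat (of_nat k)) = (B + mat (of_nat k)) ** A"
      by (simp add: matrix_distribs A(2))
    show "has_mat_deriv (\<lambda>t. mat_powr t (B + mat (of_nat k)) ** ?H k t) ((1 / t) *\<^sub>M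
        ((B + mat (of_nat k)) ** (mat_powr t (B + mat (of_nat k)) ** ?H (Suc k) t))) t"
      using horn_H2_deriv_powr_B[OF A(1) comm C t, of B' y] unfolding add_mat_Suc .
  qed auto
  then show ?thesis
    by simp
qed

lemma horn_H2_higher_deriv_powr_B':
  assumes A: "neg_poch_defined A" and C: "\<And>k. invertible (C + mat (of_nat k))"
    and CB': "C ** B' = B' ** C" and x: "x \<in> ball 0 1" and y: "y \<in> - \<real>\<^sub>\<le>\<^sub>0"
  shows "(sq_deriv ^^ r) (\<lambda>t. horn_H2 A B B' C x t ** mat_powr t B') y =
    horn_H2 A B (B' + mat (of_nat r)) C x y ** mat_powr y (B' + mat (of_nat r)) ** mat_poch B' r"
proof -
  let ?H = "\<lambda>k t. horn_H2 A B (B' + mat (of_nat k)) C x t"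
  have "(sq_deriv ^^ r) ((\<lambda>k t. ?H k t ** mat_powr t (B' + mat (of_nat k))) 0) y =
    ?H r y ** mat_powr y (B' + mat (of_nat r)) ** mat_poch B' r"
  proof (rule sq_deriv_iterate_right[OF open_slit_plane y])
    fix k and t :: complex assume t: "t \<in> - \<real>\<^sub>\<le>\<^sub>0"
    then have t': "t \<notin> \<real>\<^sub>\<le>\<^sub>0"
      by simp
    have comm: "C ** (B' + mat (of_nat k)) = (B' + mat (of_nat k)) ** C"
      by (simp add: matrix_distribs CB')
    show "has_mat_deriv (\<lambda>t. ?H k t ** mat_powr t (B' + mat (of_nat k))) ((1 / t) *\<^sub>M
        (?H (Suc k) t ** mat_powr t (B' + mat (of_nat k)) ** (B' + mat (of_nat k)))) t"
      using horn_H2_deriv_powr_B'[OF A C comm x t', of B] unfolding add_mat_Suc .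
  qed auto
  then show ?thesis
    by simp
qed

text \<open>Here the parameter moves down, and the factors \<open>C - (k + 1) I = - (I - C + k I)\<close> collected on the right
build the symbol of \<open>I - C\<close> and the sign.\<close>

lemma horn_H2_higher_deriv_powr_C:
  assumes A: "neg_poch_defined A" and C: "\<And>k. invertible (C - mat (of_nat r) + mat (of_nat k))"
    and x: "x \<in> ball 0 1 - \<real>\<^sub>\<le>\<^sub>0"
  shows "(mat_deriv ^^ r) (\<lambda>t. horn_H2 A B B' C t y ** mat_powr t (C - mat 1)) x =
    (-1) ^ r *\<^sub>M (horn_H2 A B B' (C - mat (of_nat r)) x y
      ** mat_powr x (C - mat (of_nat (r + 1))) ** mat_poch (mat 1 - C) r)"
proof -
  define H where "H k t = horn_H2 A B B' (C - mat (of_nat k)) t y ** mat_powr t (C - mat (of_nat k) - mat 1)" for k t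
  define G where "G k t = (-1) ^ k *\<^sub>M (H k t ** mat_poch (mat 1 - C) k)" for k t
  have "(mat_deriv ^^ r) (G 0) x = G r x"
  proof (rule mat_deriv_iterate[OF open_slit_disc x])
    fix k and t :: complex assume k: "k < r" and t: "t \<in> ball 0 1 - \<real>\<^sub>\<le>\<^sub>0"
    let ?C = "C - mat (of_nat k)"
    have inv: "invertible (?C - mat 1 + mat (of_nat j))" for j
    proof -
      have "?C - mat 1 + mat (of_nat j) = C - mat (of_nat r) + mat (of_nat (r - Suc k + j))"
        using k by (simp add: vec_eq_iff mat_def of_nat_diff)
      then show ?thesis
        using C by metis
    qed
    have "has_mat_deriv (H k) (H (Suc k) t ** (?C - mat 1)) t"
      unfolding H_def using horn_H2_deriv_powr_C[OF A inv t, of B B' y] unfolding diff_mat_Suc .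
    from has_mat_deriv_mult_right[OF this, of "mat_poch (mat 1 - C) k"]
    have "has_mat_deriv (\<lambda>t. H k t ** mat_poch (mat 1 - C) k)
        (H (Suc k) t ** (?C - mat 1) ** mat_poch (mat 1 - C) k) t" .
    also have "?C - mat 1 = (-1) *\<^sub>M (mat 1 - C + mat (of_nat k))"
      by (simp add: vec_eq_iff mat_def)
    finally have "has_mat_deriv (\<lambda>t. H k t ** mat_poch (mat 1 - C) k)
        ((-1) *\<^sub>M (H (Suc k) t ** mat_poch (mat 1 - C) (Suc k))) t"
      unfolding mat_poch_Suc_left' by (simp only: cscale_mult_left cscale_mult_right matrix_mul_assoc)
    from has_mat_deriv_mult_left[OF this, of "mat ((-1) ^ k)"]
    show "has_mat_deriv (G k) (G (Suc k) t) t"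
      unfolding G_def[abs_def] by (simp only: mat_mult_left cscale_cscale power_Suc2)
  qed
  then show ?thesis
    unfolding G_def[abs_def] H_def diff_mat_Suc by simp
qed

theorem theorem4p14:
  fixes A B B' C :: "complex^'d^'d" and r :: nat
  assumes C_inv: "\<And>k::nat. invertible (C + mat (of_nat k))"
    and A_def: "neg_poch_defined A"
    and r_pos: "r \<ge> 1"
  shows
    "(A ** B = B ** A \<and> neg_poch_defined (A + mat (of_nat r)) \<longrightarrow>
       (\<forall>y. (\<lambda>t. horn_H2 A B B' C t y) mat_holomorphic_on ball 0 1 \<and>
         (\<forall>x\<in>ball 0 1.
           (mat_deriv ^^ r) (\<lambda>t. horn_H2 A B B' C t y) x =
             mat_poch A r ** mat_poch B r
               ** horn_H2 (A + mat (of_nat r)) (B + mat (of_nat r)) B' (C + mat (of_nat r)) x y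
               ** matrix_inv (mat_poch C r))))
   \<and> (C ** B' = B' ** C \<longrightarrow>
       (\<forall>x\<in>ball 0 1. (\<lambda>t. horn_H2 A B B' C x t) mat_holomorphic_on UNIV \<and>
         (\<forall>y.
           (mat_deriv ^^ r) (\<lambda>t. horn_H2 A B B' C x t) y =
             (-1) ^ r *\<^sub>M (matrix_inv (mat_poch (mat 1 - A) r)
               ** horn_H2 (A - mat (of_nat r)) B (B' + mat (of_nat r)) C x y
               ** mat_poch B' r))))
   \<and> (neg_poch_defined (A + mat (of_nat r)) \<longrightarrow>
       (\<forall>y. (\<lambda>t. mat_powr t A ** horn_H2 A B B' C t (y / t))
               mat_holomorphic_on (ball 0 1 - \<real>\<^sub>\<le>\<^sub>0) \<and>
         (\<forall>x\<in>ball 0 1 - \<real>\<^sub>\<le>\<^sub>0.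
           (sq_deriv ^^ r) (\<lambda>t. mat_powr t A ** horn_H2 A B B' C t (y / t)) x =
             mat_powr x (A + mat (of_nat r)) ** mat_poch A r
               ** horn_H2 (A + mat (of_nat r)) B B' C x (y / x))))
   \<and> (A ** B = B ** A \<longrightarrow>
       (\<forall>y. (\<lambda>t. mat_powr t B ** horn_H2 A B B' C t y)
               mat_holomorphic_on (ball 0 1 - \<real>\<^sub>\<le>\<^sub>0) \<and>
         (\<forall>x\<in>ball 0 1 - \<real>\<^sub>\<le>\<^sub>0.
           (sq_deriv ^^ r) (\<lambda>t. mat_powr t B ** horn_H2 A B B' C t y) x =
             mat_powr x (B + mat (of_nat r)) ** mat_poch B r
               ** horn_H2 A (B + mat (of_nat r)) B' C x y)))
   \<and> (C ** B' = B' ** C \<longrightarrow>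
       (\<forall>x\<in>ball 0 1. (\<lambda>t. horn_H2 A B B' C x t ** mat_powr t B')
               mat_holomorphic_on (- \<real>\<^sub>\<le>\<^sub>0) \<and>
         (\<forall>y\<in>- \<real>\<^sub>\<le>\<^sub>0.
           (sq_deriv ^^ r) (\<lambda>t. horn_H2 A B B' C x t ** mat_powr t B') y =
             horn_H2 A B (B' + mat (of_nat r)) C x y
               ** mat_powr y (B' + mat (of_nat r)) ** mat_poch B' r)))
   \<and> ((\<forall>k::nat. invertible (C - mat (of_nat r) + mat (of_nat k))) \<longrightarrow>
       (\<forall>y. (\<lambda>t. horn_H2 A B B' C t y ** mat_powr t (C - mat 1))
               mat_holomorphic_on (ball 0 1 - \<real>\<^sub>\<le>\<^sub>0) \<and>
         (\<forall>x\<in>ball 0 1 - \<real>\<^sub>\<le>\<^sub>0.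
           (mat_deriv ^^ r) (\<lambda>t. horn_H2 A B B' C t y ** mat_powr t (C - mat 1)) x =
             (-1) ^ r *\<^sub>M (horn_H2 A B B' (C - mat (of_nat r)) x y
               ** mat_powr x (C - mat (of_nat (r + 1))) ** mat_poch (mat 1 - C) r))))"
proof (intro conjI impI allI ballI)
  fix y
  assume *: "A ** B = B ** A \<and> neg_poch_defined (A + mat (of_nat r))"
  then have A1: "neg_poch_defined (A + mat 1)" and AB: "A ** B = B ** A"
    using neg_poch_defined_add_le[of A r 1] r_pos by auto
  show "(\<lambda>t. horn_H2 A B B' C t y) mat_holomorphic_on ball 0 1"
    by (rule has_mat_deriv_imp_holomorphic[OF open_ball])
       (rule horn_H2_deriv_x[OF A_def A1 AB C_inv])
  show "(mat_deriv ^^ r) (\<lambda>t. horn_H2 A B B' C t y) x = mat_poch A r ** mat_poch B r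
      ** horn_H2 (A + mat (of_nat r)) (B + mat (of_nat r)) B' (C + mat (of_nat r)) x y
      ** matrix_inv (mat_poch C r)" if "x \<in> ball 0 1" for x
    using * by (intro horn_H2_higher_deriv_x[OF A_def _ AB C_inv that]) simp
next
  fix x :: complex
  assume CB': "C ** B' = B' ** C" and x: "x \<in> ball 0 1"
  show "(\<lambda>t. horn_H2 A B B' C x t) mat_holomorphic_on UNIV"
    by (rule has_mat_deriv_imp_holomorphic[OF open_UNIV])
       (rule horn_H2_deriv_y[OF A_def C_inv CB' x])
  show "(mat_deriv ^^ r) (\<lambda>t. horn_H2 A B B' C x t) y = (-1) ^ r *\<^sub>M
      (matrix_inv (mat_poch (mat 1 - A) r)
        ** horn_H2 (A - mat (of_nat r)) B (B' + mat (of_nat r)) C x y ** mat_poch B' r)" for y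
    by (rule horn_H2_higher_deriv_y[OF A_def C_inv CB' x])
next
  fix y
  assume Ar: "neg_poch_defined (A + mat (of_nat r))"
  then have A1: "neg_poch_defined (A + mat 1)"
    using neg_poch_defined_add_le[of A r 1] r_pos by auto
  show "(\<lambda>t. mat_powr t A ** horn_H2 A B B' C t (y / t)) mat_holomorphic_on (ball 0 1 - \<real>\<^sub>\<le>\<^sub>0)"
    by (rule has_mat_deriv_imp_holomorphic[OF open_slit_disc])
       (rule horn_H2_deriv_powr_A[OF A_def A1 C_inv])
  show "(sq_deriv ^^ r) (\<lambda>t. mat_powr t A ** horn_H2 A B B' C t (y / t)) x =
      mat_powr x (A + mat (of_nat r)) ** mat_poch A r ** horn_H2 (A + mat (of_nat r)) B B' C x (y / x)"
    if "x \<in> ball 0 1 - \<real>\<^sub>\<le>\<^sub>0" for x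
    by (rule horn_H2_higher_deriv_powr_A[OF A_def Ar C_inv that])
next
  fix y
  assume AB: "A ** B = B ** A"
  show "(\<lambda>t. mat_powr t B ** horn_H2 A B B' C t y) mat_holomorphic_on (ball 0 1 - \<real>\<^sub>\<le>\<^sub>0)"
    by (rule has_mat_deriv_imp_holomorphic[OF open_slit_disc])
       (rule horn_H2_deriv_powr_B[OF A_def AB C_inv])
  show "(sq_deriv ^^ r) (\<lambda>t. mat_powr t B ** horn_H2 A B B' C t y) x =
      mat_powr x (B + mat (of_nat r)) ** mat_poch B r ** horn_H2 A (B + mat (of_nat r)) B' C x y"
    if "x \<in> ball 0 1 - \<real>\<^sub>\<le>\<^sub>0" for x
    by (rule horn_H2_higher_deriv_powr_B[OF A_def AB C_inv that])
next
  fix x :: complex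
  assume CB': "C ** B' = B' ** C" and x: "x \<in> ball 0 1"
  show "(\<lambda>t. horn_H2 A B B' C x t ** mat_powr t B') mat_holomorphic_on (- \<real>\<^sub>\<le>\<^sub>0)"
    by (rule has_mat_deriv_imp_holomorphic[OF open_slit_plane])
       (rule horn_H2_deriv_powr_B'[OF A_def C_inv CB' x], simp)
  show "(sq_deriv ^^ r) (\<lambda>t. horn_H2 A B B' C x t ** mat_powr t B') y =
      horn_H2 A B (B' + mat (of_nat r)) C x y ** mat_powr y (B' + mat (of_nat r)) ** mat_poch B' r"
    if "y \<in> - \<real>\<^sub>\<le>\<^sub>0" for y
    by (rule horn_H2_higher_deriv_powr_B'[OF A_def C_inv CB' x that])
next
  fix y
  assume Cr: "\<forall>k::nat. invertible (C - mat (of_nat r) + mat (of_nat k))"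
  have C1: "invertible (C - mat 1 + mat (of_nat k))" for k
  proof -
    have "C - mat 1 + mat (of_nat k) = C - mat (of_nat r) + mat (of_nat (r - 1 + k))"
      using r_pos by (simp add: vec_eq_iff mat_def of_nat_diff)
    then show ?thesis
      using Cr by metis
  qed
  show "(\<lambda>t. horn_H2 A B B' C t y ** mat_powr t (C - mat 1)) mat_holomorphic_on (ball 0 1 - \<real>\<^sub>\<le>\<^sub>0)"
    by (rule has_mat_deriv_imp_holomorphic[OF open_slit_disc])
       (rule horn_H2_deriv_powr_C[OF A_def C1])
  show "(mat_deriv ^^ r) (\<lambda>t. horn_H2 A B B' C t y ** mat_powr t (C - mat 1)) x =
      (-1) ^ r *\<^sub>M (horn_H2 A B B' (C - mat (of_nat r)) x y
        ** mat_powr x (C - mat (of_nat (r + 1))) ** mat_poch (mat 1 - C) r)"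
    if "x \<in> ball 0 1 - \<real>\<^sub>\<le>\<^sub>0" for x
    using Cr by (intro horn_H2_higher_deriv_powr_C[OF A_def _ that]) simp
qed

end
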